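(* Let $\Omega\subset\mathbb{R}^d$, $d\in\{2,3\}$, be a polygonal (polyhedral) domain and let $f\in L^2(\Omega)^d$. Let $\{X^h\}$ be a family of conforming velocity finite element spaces, indexed by the meshwidth $h$, of continuous piecewise polynomial vector fields vanishing on $\partial\Omega$, each with a basis $\{\phi_1,\dots,\phi_N\}$, satisfying: (A1) (inverse estimate) $\|\nabla v\|\le C h^{-1}\|v\|$ for all $v\in X^h$; (A2) (norm equivalence) with $N=Ch^{-d}$, for $v=\sum_{i=1}^N a_i\phi_i$ the quantities $\|v\|$ and $\sqrt{\tfrac1N\sum_{i=1}^N a_i^2}$ are equivalent norms with equivalence constants independent of $h$. For a penalty parameter $\varepsilon>0$, let $u^\varepsilon\in X^h$ be the solution of $$(\nabla u^\varepsilon,\nabla v)+\varepsilon^{-1}(\nabla\cdot u^\varepsilon,\nabla\cdot v)=(f,v)\quad\text{for all } v\in X^h,$$ write $u^\varepsilon=\sum_{i=1}^N c_i\phi_i$ with coefficient vector $c=(c_1,\dots,c_N)^T$, and let $A$ be the $N\times N$ matrix $A_{ij}=(\nabla\phi_i,\nabla\phi_j)+\varepsilon^{-1}(\nabla\cdot\phi_i,\nabla\cdot\phi_j)$, so that $Ac=b$ with $b_j=(f,\phi_j)$. Let $|\cdot|$ denote the Euclidean vector norm and the induced matrix norm, let $\kappa=|A||A^{-1}|$, and let $\kappa(u^\varepsilon):=\kappa(c)=|A^{-1}|\,|Ac|/|c|$. Let $f^h$ be the $L^2(\Omega)$-projection of $f$ into $X^h$. Then there is a constant $C$ independent of $h$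 and $\varepsilon$ such that $$\max_{f^h}\kappa(u^\varepsilon)=\kappa\le C\left(h^{-2}+\varepsilon^{-1}h^{-2}\right),$$ $$\kappa(u^\varepsilon)\le C\,\frac{\|f^h\|}{\|u^\varepsilon\|},\qquad\text{and}\qquad \kappa(u^\varepsilon)\le C h^{-2}\left(1+\frac{h}{\varepsilon}\,\frac{\|\nabla\cdot u^\varepsilon\|}{\|u^\varepsilon\|}\right).$$
   Context: $(\cdot,\cdot)$ and $\|\cdot\|$ denote the $L^2(\Omega)$ inner product and norm. The problem is the penalty approximation of the Stokes problem $-\Delta u+\nabla p=f$, $\nabla\cdot u=0$ in $\Omega$, $u=0$ on $\partial\Omega$. The generic constants $C$ in (A1), (A2) and the conclusion are independent of $h$ and $\varepsilon$. The effective condition number (condition number at the solution) of a nonsingular system $Ac=b$ is $\kappa(c)=|A^{-1}|\,|Ac|/|c|$. The maximum in the first assertion is over the right-hand side data $f^h\in X^h$. *)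

theory Defs
  imports "HOL-Analysis.Analysis"
begin

text \<open>A polygonal (d=2) / polyhedral (d=3) domain: a bounded connected open set,
  regular open (no slits), whose closure is a finite union of d-simplices.\<close>
definition polyhedral_domain :: "(real^'d) set \<Rightarrow> bool" where
  "polyhedral_domain \<Omega> \<longleftrightarrow> open \<Omega> \<and> connected \<Omega> \<and> bounded \<Omega> \<and> \<Omega> \<noteq> {} \<and>
     \<Omega> = interior (closure \<Omega>) \<and>
     (\<exists>\<T>. finite \<T> \<and> (\<forall>T\<in>\<T>. int CARD('d) simplex T) \<and> closure \<Omega> = \<Union>\<T>)"

definition is_mesh :: "(real^'d) set \<Rightarrow> real \<Rightarrow> (real^'d) set set \<Rightarrow> bool" where
  "is_mesh \<Omega> h \<T> \<longleftrightarrow> finite \<T> \<and> \<T> \<noteq> {} \<and> (\<forall>T\<in>\<T>. int CARD('d) simplex T) \<and>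
     \<Union>\<T> = closure \<Omega> \<and>
     (\<forall>T\<in>\<T>. \<forall>T'\<in>\<T>. T \<noteq> T' \<longrightarrow> interior T \<inter> interior T' = {}) \<and>
     h = Max (diameter ` \<T>)"

definition fe_space :: "nat \<Rightarrow> (nat \<Rightarrow> real^'d \<Rightarrow> real^'d) \<Rightarrow> (real^'d \<Rightarrow> real^'d) set" where
  "fe_space N \<phi> = {(\<lambda>x. \<Sum>i<N. a i *\<^sub>R \<phi> i x) | a. True}"

definition fe_basis :: "(real^'d) set \<Rightarrow> (real^'d) set set \<Rightarrow> nat \<Rightarrow> (nat \<Rightarrow> real^'d \<Rightarrow> real^'d) \<Rightarrow> bool" where
  "fe_basis \<Omega> \<T> N \<phi> \<longleftrightarrow>
     (\<forall>i<N. continuous_on (closure \<Omega>) (\<phi> i) \<and> (\<forall>x\<in>frontier \<Omega>. \<phi> i x = 0) \<and>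
        (\<forall>T\<in>\<T>. \<exists>p. polynomial_function p \<and> (\<forall>x\<in>T. \<phi> i x = p x))) \<and>
     (\<forall>a. (\<forall>x\<in>\<Omega>. (\<Sum>i<N. a i *\<^sub>R \<phi> i x) = 0) \<longrightarrow> (\<forall>i<N. a i = 0))"

definition L2 :: "(real^'d) set \<Rightarrow> (real^'d \<Rightarrow> real^'d) \<Rightarrow> bool" where
  "L2 \<Omega> f \<longleftrightarrow> f \<in> borel_measurable (lebesgue_on \<Omega>) \<and>
     integrable (lebesgue_on \<Omega>) (\<lambda>x. (norm (f x))\<^sup>2)"

definition L2ip :: "(real^'d) set \<Rightarrow> (real^'d \<Rightarrow> 'b::euclidean_space) \<Rightarrow> (real^'d \<Rightarrow> 'b) \<Rightarrow> real" where
  "L2ip \<Omega> u v = integral\<^sup>L (lebesgue_on \<Omega>) (\<lambda>x. u x \<bullet> v x)"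

definition L2norm :: "(real^'d) set \<Rightarrow> (real^'d \<Rightarrow> 'b::euclidean_space) \<Rightarrow> real" where
  "L2norm \<Omega> u = sqrt (L2ip \<Omega> u u)"

text \<open>Gradient (Jacobian matrix, entry i j = d v_i / d x_j), defined a.e. (on element
  interiors) for piecewise polynomials; it coincides with the weak gradient.\<close>
definition grad :: "(real^'d \<Rightarrow> real^'d) \<Rightarrow> real^'d \<Rightarrow> real^'d^'d" where
  "grad v x = matrix (frechet_derivative v (at x))"

definition divg :: "(real^'d \<Rightarrow> real^'d) \<Rightarrow> real^'d \<Rightarrow> real" where
  "divg v x = trace (grad v x)"

definition vnorm :: "nat \<Rightarrow> (nat \<Rightarrow> real) \<Rightarrow> real" where
  "vnorm N a = sqrt (\<Sum>i<N. (a i)\<^sup>2)"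

definition mvmult :: "nat \<Rightarrow> (nat \<Rightarrow> nat \<Rightarrow> real) \<Rightarrow> (nat \<Rightarrow> real) \<Rightarrow> (nat \<Rightarrow> real)" where
  "mvmult N M a = (\<lambda>i. \<Sum>j<N. M i j * a j)"

definition mmult :: "nat \<Rightarrow> (nat \<Rightarrow> nat \<Rightarrow> real) \<Rightarrow> (nat \<Rightarrow> nat \<Rightarrow> real) \<Rightarrow> (nat \<Rightarrow> nat \<Rightarrow> real)" where
  "mmult N M P = (\<lambda>i j. \<Sum>k<N. M i k * P k j)"

definition matnorm :: "nat \<Rightarrow> (nat \<Rightarrow> nat \<Rightarrow> real) \<Rightarrow> real" where
  "matnorm N M = Sup {vnorm N (mvmult N M a) | a. vnorm N a = 1}"

definition matinv :: "nat \<Rightarrow> (nat \<Rightarrow> nat \<Rightarrow> real) \<Rightarrow> (nat \<Rightarrow> nat \<Rightarrow> real)" where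
  "matinv N M = (SOME B. \<forall>i<N. \<forall>j<N.
      mmult N B M i j = (if i = j then 1 else 0) \<and> mmult N M B i j = (if i = j then 1 else 0))"

definition cond_num :: "nat \<Rightarrow> (nat \<Rightarrow> nat \<Rightarrow> real) \<Rightarrow> real" where
  "cond_num N M = matnorm N M * matnorm N (matinv N M)"

definition eff_cond :: "nat \<Rightarrow> (nat \<Rightarrow> nat \<Rightarrow> real) \<Rightarrow> (nat \<Rightarrow> real) \<Rightarrow> real" where
  "eff_cond N M c = matnorm N (matinv N M) * vnorm N (mvmult N M c) / vnorm N c"

definition penalty_matrix :: "(real^'d) set \<Rightarrow> (nat \<Rightarrow> real^'d \<Rightarrow> real^'d) \<Rightarrow> real \<Rightarrow> nat \<Rightarrow> nat \<Rightarrow> real" where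
  "penalty_matrix \<Omega> \<phi> \<epsilon> i j =
     L2ip \<Omega> (grad (\<phi> i)) (grad (\<phi> j)) + inverse \<epsilon> * L2ip \<Omega> (divg (\<phi> i)) (divg (\<phi> j))"

definition fe_fun :: "nat \<Rightarrow> (nat \<Rightarrow> real^'d \<Rightarrow> real^'d) \<Rightarrow> (nat \<Rightarrow> real) \<Rightarrow> real^'d \<Rightarrow> real^'d" where
  "fe_fun N \<phi> c = (\<lambda>x. \<Sum>i<N. c i *\<^sub>R \<phi> i x)"

definition penalty_solution :: "(real^'d) set \<Rightarrow> nat \<Rightarrow> (nat \<Rightarrow> real^'d \<Rightarrow> real^'d) \<Rightarrow> real \<Rightarrow>
    (real^'d \<Rightarrow> real^'d) \<Rightarrow> (nat \<Rightarrow> real) \<Rightarrow> bool" where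
  "penalty_solution \<Omega> N \<phi> \<epsilon> f c \<longleftrightarrow>
     (\<forall>v\<in>fe_space N \<phi>.
        L2ip \<Omega> (grad (fe_fun N \<phi> c)) (grad v) + inverse \<epsilon> * L2ip \<Omega> (divg (fe_fun N \<phi> c)) (divg v)
        = L2ip \<Omega> f v)"

definition L2_projection :: "(real^'d) set \<Rightarrow> nat \<Rightarrow> (nat \<Rightarrow> real^'d \<Rightarrow> real^'d) \<Rightarrow>
    (real^'d \<Rightarrow> real^'d) \<Rightarrow> (real^'d \<Rightarrow> real^'d) \<Rightarrow> bool" where
  "L2_projection \<Omega> N \<phi> f fh \<longleftrightarrow> fh \<in> fe_space N \<phi> \<and> (\<forall>v\<in>fe_space N \<phi>. L2ip \<Omega> fh v = L2ip \<Omega> f v)"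

end

theory Submission
  imports Defs "Jordan_Normal_Form.Determinant"
begin

text \<open>The penalty matrix represents the energy form on coefficient vectors. Its norm is bounded by
  Cauchy--Schwarz, the inverse estimate, the pointwise bound of the divergence by the gradient and
  the norm equivalence. The norm of its inverse is \<open>O(N)\<close> by the Poincare inequality on \<open>\<Omega>\<close> together
  with the norm equivalence. The two bounds on the effective condition number arise from two
  estimates of the residual \<open>|Ac|\<close>, tested against an arbitrary finite element function: by
  \<open>(f\<^sup>h, v)\<close> and by the energy form itself, applying the inverse estimate to both gradients but
  keeping the divergence of \<open>u\<close>. The maximum is attained at a unit vector \<open>c\<close> with \<open>|Ac| = |A|\<close>,
  the data being recovered from \<open>Ac\<close> by solving a system with the Gram matrix.\<close>

text \<open>Powers of N are what has to balance. By the norm equivalence a coefficient vector of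
  length |a| stands for a function whose L2 norm is |a| / sqrt N up to constants, so |A| carries
  1/N, the inverse carries N, and their product is free of N; a residual estimate carries 1/sqrt N,
  and 1/|c| supplies the other root. The obstacle is the Poincare inequality: finite element
  functions are only piecewise smooth, and their gradient is arbitrary on the mesh skeleton. A
  generic line in a fixed direction meets the skeleton in finitely many points, so the fundamental
  theorem of calculus with a finite exceptional set applies on it; the function is extended by zero,
  so that a long enough translation leaves its support. In inner products the arbitrary values do no
  harm because the skeleton is null, and essential boundedness on a domain of finite measure makes
  every product integrable.\<close>

no_notation Matrix.vec_index (infixl "$" 100)
no_notation Matrix.scalar_prod (infix "\<bullet>" 70)

subsection \<open>A Poincare inequality for piecewise smooth functions\<close>

text \<open>Once \<open>a < b\<close> lie in \<open>S\<close>, any third element would complete a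
  chain of three, so \<open>S\<close> has at most two elements. It is applied to the parameters at
  which a line crosses the frontier of a convex set.\<close>

lemma finite_no_three_chain:
  fixes S :: "real set"
  assumes "\<And>a b c. \<lbrakk>a \<in> S; b \<in> S; c \<in> S; a < b; b < c\<rbrakk> \<Longrightarrow> False"
  shows "finite S"
proof (cases "\<exists>a\<in>S. \<exists>b\<in>S. a < b")
  case True
  then obtain a b where ab: "a \<in> S" "b \<in> S" "a < b" by blast
  then have "c = a \<or> c = b" if "c \<in> S" for c
    using assms[of c a b] assms[of a c b] assms[of a b c] that by (smt (verit))
  then have "S \<subseteq> {a, b}" by blast
  then show ?thesis by (rule finite_subset) simp
next
  case False
  then have "x = y" if "x \<in> S" "y \<in> S" for x y
    using that by (meson linorder_cases)
  then have "S = {} \<or> (\<exists>x. S = {x})" by blast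
  then show ?thesis by auto
qed

lemma line_point_between:
  fixes x e :: "'a::real_vector"
  assumes "a < s" "s < b"
  obtains u where "0 < u" "u < 1" "x + s *\<^sub>R e = (1 - u) *\<^sub>R (x + a *\<^sub>R e) + u *\<^sub>R (x + b *\<^sub>R e)"
proof
  define u where "u = (s - a) / (b - a)"
  show "0 < u" "u < 1" using assms by (auto simp: u_def)
  have "u * (b - a) = s - a" using assms by (simp add: u_def)
  then have s: "s = a + u * b - u * a" by (simp add: right_diff_distrib)
  show "x + s *\<^sub>R e = (1 - u) *\<^sub>R (x + a *\<^sub>R e) + u *\<^sub>R (x + b *\<^sub>R e)"
    unfolding s by (simp add: left_diff_distrib scaleR_left_diff_distrib scaleR_left_distrib scaleR_right_distrib scaleR_right_diff_distrib)
qed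

text \<open>A line that meets the interior of a convex set crosses its frontier at most twice; otherwise its
  trace on the set lies in the frontier, and is an interval of length zero.\<close>
lemma finite_line_convex_frontier:
  fixes T :: "'a::euclidean_space set"
  assumes "convex T" "closed T" and null: "{t. x + t *\<^sub>R e \<in> frontier T} \<in> null_sets lborel"
  shows "finite {t. x + t *\<^sub>R e \<in> frontier T}"
proof (rule finite_no_three_chain, goal_cases)
  case (1 a b c)
  have fr: "frontier T = T - interior T"
    using \<open>closed T\<close> by (simp add: frontier_def)
  have abc: "x + a *\<^sub>R e \<in> T" "x + b *\<^sub>R e \<in> T" "x + c *\<^sub>R e \<in> T"
    "x + b *\<^sub>R e \<notin> interior T" "x + c *\<^sub>R e \<notin> interior T"
    using 1(1-3) unfolding fr by blast+
  have "x + s *\<^sub>R e \<in> frontier T" if s: "s \<in> {a<..<b}" for s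
  proof -
    obtain u where u: "0 < u" "u < 1" "x + s *\<^sub>R e = (1 - u) *\<^sub>R (x + a *\<^sub>R e) + u *\<^sub>R (x + b *\<^sub>R e)"
      using line_point_between[of a s b x e] s by auto
    then have inT: "x + s *\<^sub>R e \<in> T"
      using abc convexD[OF \<open>convex T\<close>, of "x + a *\<^sub>R e" "x + b *\<^sub>R e" "1 - u" u] by simp
    have "x + s *\<^sub>R e \<notin> interior T"
    proof
      \<comment> \<open>The point with parameter \<open>b\<close> lies strictly between an interior
        point and a point of the closure, which makes it interior by convexity and contradicts its
        being on the frontier.\<close>
      assume int: "x + s *\<^sub>R e \<in> interior T"
      have ne: "x + s *\<^sub>R e \<noteq> x + c *\<^sub>R e"
        using int abc by metis
      obtain u where "0 < u" "u < 1" "x + b *\<^sub>R e = (1 - u) *\<^sub>R (x + s *\<^sub>R e) + u *\<^sub>R (x + c *\<^sub>R e)"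
        using line_point_between[of s b c x e] s 1 by auto
      then have "x + b *\<^sub>R e \<in> open_segment (x + s *\<^sub>R e) (x + c *\<^sub>R e)"
        using ne unfolding in_segment by blast
      moreover have "x + c *\<^sub>R e \<in> closure T" using abc closure_subset by blast
      ultimately have "x + b *\<^sub>R e \<in> interior T"
        using in_interior_closure_convex_segment[OF \<open>convex T\<close> int] by blast
      then show False using abc by blast
    qed
    with inT fr show ?thesis by blast
  qed
  then have "{a<..<b} \<subseteq> {t. x + t *\<^sub>R e \<in> frontier T}" by blast
  then have "{a<..<b} \<in> null_sets lborel"
    by (intro null_sets_subset[OF null]) auto
  then have "emeasure lborel {a<..<b} = 0" by blast
  then show False using 1 by simp
qed

text \<open>For fixed \<open>t\<close> the points \<open>x\<close> with
  \<open>x + t *\<^sub>R e \<in> Z\<close> form a translate of \<open>Z\<close>, hence a null set;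
  exchanging the two almost-everywhere quantifiers on the product space gives the claim. Nullity in
  \<open>lborel\<close> makes \<open>Z\<close> Borel, which provides the measurability that the
  exchange requires.\<close>

lemma AE_line_not_in_null:
  fixes Z :: "'a::euclidean_space set"
  assumes Z: "Z \<in> null_sets lborel"
  shows "AE x in lborel. {t::real. x + t *\<^sub>R e \<in> Z} \<in> null_sets lborel"
proof -
  have [measurable]: "Z \<in> sets borel" using Z by auto
  have meas: "{(x, t::real). x + t *\<^sub>R e \<notin> Z} \<in> sets (lborel \<Otimes>\<^sub>M lborel)"
  proof -
    have "(\<lambda>(x, t::real). x + t *\<^sub>R e) \<in> borel_measurable (borel \<Otimes>\<^sub>M borel)" by measurable
    then have "(\<lambda>(x, t::real). x + t *\<^sub>R e) -` (-Z) \<inter> space (borel \<Otimes>\<^sub>M borel) \<in> sets (borel \<Otimes>\<^sub>M borel)"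
      by (rule measurable_sets) auto
    moreover have "(\<lambda>(x, t::real). x + t *\<^sub>R e) -` (-Z) \<inter> space (borel \<Otimes>\<^sub>M borel) = {(x, t::real). x + t *\<^sub>R e \<notin> Z}"
      by (auto simp: space_pair_measure)
    moreover have "sets (lborel \<Otimes>\<^sub>M lborel) = sets ((borel :: 'a measure) \<Otimes>\<^sub>M (borel :: real measure))"
      by (intro sets_pair_measure_cong) auto
    ultimately show ?thesis by simp
  qed
  have tr: "AE x in lborel. x + t *\<^sub>R e \<notin> Z" for t :: real
  proof -
    have "AE y in distr lborel borel (\<lambda>x. t *\<^sub>R e + x). y \<notin> Z"
      unfolding lborel_distr_plus using Z by (rule AE_not_in)
    then show ?thesis
      by (subst (asm) AE_distr_iff) (simp_all add: add.commute)
  qed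
  have "AE x in lborel. AE t in lborel. x + (t::real) *\<^sub>R e \<notin> Z"
    using lborel_pair.AE_commute[of "\<lambda>x t. x + t *\<^sub>R e \<notin> Z"] meas tr
    by (simp add: space_pair_measure case_prod_unfold)
  then show ?thesis
  proof (rule eventually_mono)
    fix x assume ae: "AE t in lborel. x + (t::real) *\<^sub>R e \<notin> Z"
    have "(\<lambda>t::real. x + t *\<^sub>R e) -` Z \<inter> space borel \<in> sets borel"
      by (rule measurable_sets[of _ borel borel]) measurable
    then have "{t::real. x + t *\<^sub>R e \<in> Z} \<in> sets lborel" by (simp add: vimage_def)
    then show "{t::real. x + t *\<^sub>R e \<in> Z} \<in> null_sets lborel"
      using AE_iff_null_sets[of "{t::real. x + t *\<^sub>R e \<in> Z}" lborel] ae by simp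
  qed
qed

text \<open>Cauchy--Schwarz against the constant 1 for vector-valued \<open>G\<close>: with
  \<open>m\<close> the mean of \<open>G\<close> over the interval, expand the integral of the
  squared norm of \<open>G t - m\<close>, which is nonnegative. The bound \<open>B\<close> supplies
  integrability.\<close>

lemma norm_integral_square_le:
  fixes G :: "real \<Rightarrow> 'b::euclidean_space"
  assumes R: "0 < R" and [measurable]: "G \<in> borel_measurable borel" and bd: "\<And>t. norm (G t) \<le> B"
  shows "(norm (integral {0..R} G))\<^sup>2 \<le> R * integral {0..R} (\<lambda>t. (norm (G t))\<^sup>2)"
    and "set_integrable lborel {0..R} G"
    and "set_integrable lborel {0..R} (\<lambda>t. (norm (G t))\<^sup>2)"
proof -
  show i1: "set_integrable lborel {0..R} G"
    unfolding set_integrable_def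
    by (rule integrableI_bounded_set_indicator[where B=B]) (use bd R in \<open>auto\<close>)
  have "(norm (G t))\<^sup>2 \<le> B\<^sup>2" for t using bd[of t] by (intro power_mono) auto
  then show i2: "set_integrable lborel {0..R} (\<lambda>t. (norm (G t))\<^sup>2)"
    unfolding set_integrable_def
    using R by (intro integrableI_bounded_set_indicator[where B="B\<^sup>2"]) auto
  have G: "G integrable_on {0..R}" and N: "(\<lambda>t. (norm (G t))\<^sup>2) integrable_on {0..R}"
    using i1 i2 by (auto intro: set_borel_integral_eq_integral)
  define m where "m = (1/R) *\<^sub>R integral {0..R} G"
  have Im: "integral {0..R} G = R *\<^sub>R m" using R by (simp add: m_def)
  have Gm: "((\<lambda>t. G t \<bullet> m) has_integral (integral {0..R} G \<bullet> m)) {0..R}"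
    using has_integral_linear[OF integrable_integral[OF G] bounded_linear_inner_left[of m]] by (simp add: o_def)
  have "((\<lambda>t. (norm (G t))\<^sup>2 - 2 * (G t \<bullet> m) + (norm m)\<^sup>2) has_integral
     (integral {0..R} (\<lambda>t. (norm (G t))\<^sup>2) - 2 * (integral {0..R} G \<bullet> m) + R * (norm m)\<^sup>2)) {0..R}"
    using R has_integral_const_real[of "(norm m)\<^sup>2" 0 R]
    by (intro has_integral_add has_integral_diff has_integral_mult_right integrable_integral N Gm) auto
  moreover have "(norm (G t))\<^sup>2 - 2 * (G t \<bullet> m) + (norm m)\<^sup>2 = (norm (G t - m))\<^sup>2" for t
    by (simp add: power2_norm_eq_inner algebra_simps inner_commute)
  ultimately have "0 \<le> integral {0..R} (\<lambda>t. (norm (G t))\<^sup>2) - 2 * (integral {0..R} G \<bullet> m) + R * (norm m)\<^sup>2"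
    by (auto elim!: has_integral_nonneg)
  then have "R * (norm m)\<^sup>2 \<le> integral {0..R} (\<lambda>t. (norm (G t))\<^sup>2)"
    by (simp add: Im power2_norm_eq_inner)
  then have "R * (R * (norm m)\<^sup>2) \<le> R * integral {0..R} (\<lambda>t. (norm (G t))\<^sup>2)"
    using R by (intro mult_left_mono) auto
  then show "(norm (integral {0..R} G))\<^sup>2 \<le> R * integral {0..R} (\<lambda>t. (norm (G t))\<^sup>2)"
    using R by (simp add: Im power_mult_distrib power2_eq_square mult_ac)
qed

text \<open>The line integral of \<open>G\<close> from \<open>x\<close> to \<open>x + R *\<^sub>R e\<close> is \<open>- v x\<close> for almost every \<open>x\<close>; integrating the
  Cauchy--Schwarz bound over \<open>x\<close> and using translation invariance avoids any splitting of coordinates.\<close>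
lemma poincare_along_direction:
  fixes v G :: "'a::euclidean_space \<Rightarrow> 'b::euclidean_space"
  assumes R: "0 < R"
    and contv: "continuous_on UNIV v"
    and far: "\<And>x. v x \<noteq> 0 \<Longrightarrow> v (x + R *\<^sub>R e) = 0"
    and [measurable]: "G \<in> borel_measurable borel" and bd: "\<And>x. norm (G x) \<le> B"
    and fin: "finite \<T>" and T: "\<And>T. T \<in> \<T> \<Longrightarrow> convex T \<and> closed T"
    and deriv: "\<And>x. x \<notin> \<Union>(frontier ` \<T>) \<Longrightarrow>
       ((\<lambda>t. v (x + t *\<^sub>R e)) has_vector_derivative G x) (at 0)"
  shows "(\<integral>\<^sup>+x. ennreal ((norm (v x))\<^sup>2) \<partial>lborel) \<le> ennreal (R\<^sup>2) * (\<integral>\<^sup>+x. ennreal ((norm (G x))\<^sup>2) \<partial>lborel)"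
proof -
  let ?Z = "\<Union>(frontier ` \<T>)"
  have [measurable]: "v \<in> borel_measurable borel" using contv by (rule borel_measurable_continuous_onI)
  have frT: "frontier T \<in> null_sets lborel" if "T \<in> \<T>" for T
  proof -
    have "negligible (frontier T)" using T that by (simp add: negligible_convex_frontier)
    then have "frontier T \<in> null_sets lebesgue" by (simp add: negligible_iff_null_sets)
    \<comment> \<open>A frontier is closed, hence Borel, so nullity for the completed measure
      descends to \<open>lborel\<close>.\<close>
    then show ?thesis
      using null_sets_completion_iff[of "frontier T" lborel] by simp
  qed
  have "AE x in lborel. \<forall>T\<in>\<T>. {t::real. x + t *\<^sub>R e \<in> frontier T} \<in> null_sets lborel"
    using fin frT by (intro AE_finite_allI AE_line_not_in_null) auto
  then have "AE x in lborel. ennreal ((norm (v x))\<^sup>2) \<le>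
      ennreal R * (\<integral>\<^sup>+t. ennreal ((norm (G (x + t *\<^sub>R e)))\<^sup>2) * indicator {0..R} t \<partial>lborel)"
  proof (rule eventually_mono)
    fix x assume x: "\<forall>T\<in>\<T>. {t::real. x + t *\<^sub>R e \<in> frontier T} \<in> null_sets lborel"
    show "ennreal ((norm (v x))\<^sup>2) \<le>
      ennreal R * (\<integral>\<^sup>+t. ennreal ((norm (G (x + t *\<^sub>R e)))\<^sup>2) * indicator {0..R} t \<partial>lborel)"
    \<comment> \<open>Where \<open>v x = 0\<close> the estimate is trivial; elsewhere
      \<open>far\<close> provides the zero at the other end of the segment.\<close>
    proof (cases "v x = 0")
      case False
      let ?g = "\<lambda>t. G (x + t *\<^sub>R e)"
      have "finite {t::real. x + t *\<^sub>R e \<in> ?Z}"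
      proof -
        have "{t::real. x + t *\<^sub>R e \<in> ?Z} = (\<Union>T\<in>\<T>. {t. x + t *\<^sub>R e \<in> frontier T})" by auto
        then show ?thesis
          using fin T x by (simp add: finite_line_convex_frontier)
      qed
      then have "(?g has_integral (v (x + R *\<^sub>R e) - v (x + 0 *\<^sub>R e))) {0..R}"
      proof (rule fundamental_theorem_of_calculus_interior_strong)
        show "0 \<le> R" using R by simp
        show "continuous_on {0..R} (\<lambda>t. v (x + t *\<^sub>R e))"
          by (intro continuous_on_compose2[OF contv] continuous_intros) auto
        fix t assume t: "t \<in> {0<..<R} - {t. x + t *\<^sub>R e \<in> ?Z}"
        have "((\<lambda>s. v (x + t *\<^sub>R e + s *\<^sub>R e)) has_vector_derivative ?g t) (at 0)"
          using t by (intro deriv) auto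
        then have "((\<lambda>s. v (x + t *\<^sub>R e + s *\<^sub>R e)) has_derivative (\<lambda>h. h *\<^sub>R ?g t)) (at (t - t))"
          by (simp add: has_vector_derivative_def)
        then have "((\<lambda>s. v (x + t *\<^sub>R e + s *\<^sub>R e)) \<circ> (\<lambda>s. s - t) has_derivative (\<lambda>h. h *\<^sub>R ?g t) \<circ> (\<lambda>h. h)) (at t)"
          by (intro diff_chain_at has_derivative_diff[where g'="\<lambda>_. 0", simplified] has_derivative_ident has_derivative_const)
        moreover have "(\<lambda>s. v (x + t *\<^sub>R e + s *\<^sub>R e)) \<circ> (\<lambda>s. s - t) = (\<lambda>s. v (x + s *\<^sub>R e))"
          by (simp add: fun_eq_iff scaleR_left_diff_distrib)
        ultimately show "((\<lambda>t. v (x + t *\<^sub>R e)) has_vector_derivative ?g t) (at t)"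
          by (simp add: has_vector_derivative_def o_def)
      qed
      then have "integral {0..R} ?g = - v x"
        using far[OF False] by (simp add: integral_unique)
      moreover have gm: "?g \<in> borel_measurable borel" by measurable
      note ni = norm_integral_square_le[OF R gm bd]
      ultimately have "(norm (v x))\<^sup>2 \<le> R * integral {0..R} (\<lambda>t. (norm (?g t))\<^sup>2)"
        using ni(1) by simp
      also have "integral {0..R} (\<lambda>t. (norm (?g t))\<^sup>2) = (LINT t:{0..R}|lborel. (norm (?g t))\<^sup>2)"
        using set_borel_integral_eq_integral(2)[OF ni(3)] by simp
      finally have "ennreal ((norm (v x))\<^sup>2) \<le> ennreal (R * (LINT t:{0..R}|lborel. (norm (?g t))\<^sup>2))"
        by (rule ennreal_leI)
      also have "\<dots> = ennreal R * ennreal (LINT t:{0..R}|lborel. (norm (?g t))\<^sup>2)"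
        using R by (simp add: ennreal_mult' )
      also have "ennreal (LINT t:{0..R}|lborel. (norm (?g t))\<^sup>2) =
          (\<integral>\<^sup>+t. ennreal ((norm (?g t))\<^sup>2) * indicator {0..R} t \<partial>lborel)"
        using ni(3) unfolding set_lebesgue_integral_def set_integrable_def
        by (subst nn_integral_eq_integral[symmetric])
           (auto simp: indicator_def intro!: nn_integral_cong)
      finally show ?thesis .
    qed simp
  qed
  then have "(\<integral>\<^sup>+x. ennreal ((norm (v x))\<^sup>2) \<partial>lborel) \<le>
      (\<integral>\<^sup>+x. ennreal R * (\<integral>\<^sup>+t. ennreal ((norm (G (x + t *\<^sub>R e)))\<^sup>2) * indicator {0..R} t \<partial>lborel) \<partial>lborel)"
    by (rule nn_integral_mono_AE)
  also have "\<dots> = ennreal R * (\<integral>\<^sup>+x. (\<integral>\<^sup>+t. ennreal ((norm (G (x + t *\<^sub>R e)))\<^sup>2) * indicator {0..R} t \<partial>lborel) \<partial>lborel)"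
    by (rule nn_integral_cmult) measurable
  also have "(\<integral>\<^sup>+x. (\<integral>\<^sup>+t. ennreal ((norm (G (x + t *\<^sub>R e)))\<^sup>2) * indicator {0..R} t \<partial>lborel) \<partial>lborel) =
     (\<integral>\<^sup>+t. (\<integral>\<^sup>+x. ennreal ((norm (G (x + t *\<^sub>R e)))\<^sup>2) * indicator {0..R} t \<partial>lborel) \<partial>lborel)"
    by (rule lborel_pair.Fubini') measurable
  also have "\<dots> = (\<integral>\<^sup>+t. (\<integral>\<^sup>+x. ennreal ((norm (G x))\<^sup>2) \<partial>lborel) * indicator {0..R} t \<partial>lborel)"
  proof (rule nn_integral_cong)
    fix t :: real
    have "(\<integral>\<^sup>+x. ennreal ((norm (G x))\<^sup>2) \<partial>lborel) =
       (\<integral>\<^sup>+x. ennreal ((norm (G x))\<^sup>2) \<partial>distr lborel borel (\<lambda>x. t *\<^sub>R e + x))"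
      by (simp only: lborel_distr_plus)
    also have "\<dots> = (\<integral>\<^sup>+x. ennreal ((norm (G (x + t *\<^sub>R e)))\<^sup>2) \<partial>lborel)"
      by (subst nn_integral_distr) (auto simp: add.commute)
    finally have *: "(\<integral>\<^sup>+x. ennreal ((norm (G x))\<^sup>2) \<partial>lborel) = (\<integral>\<^sup>+x. ennreal ((norm (G (x + t *\<^sub>R e)))\<^sup>2) \<partial>lborel)" .
    show "(\<integral>\<^sup>+x. ennreal ((norm (G (x + t *\<^sub>R e)))\<^sup>2) * indicator {0..R} t \<partial>lborel) =
        (\<integral>\<^sup>+x. ennreal ((norm (G x))\<^sup>2) \<partial>lborel) * indicator {0..R} t"
      unfolding * by (rule nn_integral_multc) measurable
  qed
  \<comment> \<open>This second factor \<open>R\<close> is the length of the range of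
    \<open>t\<close>; the first one came from Cauchy--Schwarz on the segment.\<close>
  also have "\<dots> = (\<integral>\<^sup>+x. ennreal ((norm (G x))\<^sup>2) \<partial>lborel) * ennreal R"
    using R by (simp add: nn_integral_cmult)
  finally have le: "(\<integral>\<^sup>+x. ennreal ((norm (v x))\<^sup>2) \<partial>lborel) \<le>
      ennreal R * ((\<integral>\<^sup>+x. ennreal ((norm (G x))\<^sup>2) \<partial>lborel) * ennreal R)" .
  have "ennreal (R\<^sup>2) = ennreal R * ennreal R"
    using R by (simp add: power2_eq_square ennreal_mult)
  then show ?thesis
    using le by (simp only: mult.assoc mult.commute mult.left_commute)
qed

subsection \<open>Piecewise polynomials on a simplicial mesh\<close>

text \<open>A class that contains finite element functions together with their gradients and
  divergences, is closed under linear combinations, and has integrable products on a set of finite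
  measure.\<close>

definition ess_bounded :: "(real^'d) set \<Rightarrow> (real^'d \<Rightarrow> 'b::euclidean_space) \<Rightarrow> bool" where
  "ess_bounded \<Omega> g \<longleftrightarrow> g \<in> borel_measurable (lebesgue_on \<Omega>) \<and> (\<exists>B. AE x in lebesgue_on \<Omega>. norm (g x) \<le> B)"

text \<open>What \<open>fe_basis\<close> demands of each single basis function, separated from
  linear independence so that it passes to all linear combinations.\<close>

definition pw_poly :: "(real^'d) set \<Rightarrow> (real^'d) set set \<Rightarrow> (real^'d \<Rightarrow> real^'d) \<Rightarrow> bool" where
  "pw_poly \<Omega> \<T> v \<longleftrightarrow> continuous_on (closure \<Omega>) v \<and> (\<forall>x\<in>frontier \<Omega>. v x = 0) \<and>
     (\<forall>T\<in>\<T>. \<exists>p. polynomial_function p \<and> (\<forall>x\<in>T. v x = p x))"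

text \<open>The induction follows the derivative along a fixed direction \<open>y\<close>: as a
  function of the base point it is again a polynomial, which later gives continuity of the
  Jacobian.\<close>

lemma real_polynomial_function_has_derivative:
  assumes "real_polynomial_function p"
  shows "\<exists>D. (\<forall>y. real_polynomial_function (\<lambda>x. D x y)) \<and> (\<forall>x. (p has_derivative D x) (at x))"
  using assms
proof induction
  case (linear f)
  then show ?case
    by (intro exI[of _ "\<lambda>_. f"]) (auto intro: bounded_linear.has_derivative)
next
  case (const c)
  then show ?case by (intro exI[of _ "\<lambda>_ _. 0"]) auto
next
  case (add f g)
  then obtain F G where "\<forall>y. real_polynomial_function (\<lambda>x. F x y)" "\<forall>x. (f has_derivative F x) (at x)"
    "\<forall>y. real_polynomial_function (\<lambda>x. G x y)" "\<forall>x. (g has_derivative G x) (at x)" by blast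
  then show ?case
    by (intro exI[of _ "\<lambda>x y. F x y + G x y"]) (auto intro: has_derivative_add)
next
  case (mult f g)
  then obtain F G where "\<forall>y. real_polynomial_function (\<lambda>x. F x y)" "\<forall>x. (f has_derivative F x) (at x)"
    "\<forall>y. real_polynomial_function (\<lambda>x. G x y)" "\<forall>x. (g has_derivative G x) (at x)" by blast
  with mult.hyps show ?case
    by (intro exI[of _ "\<lambda>x y. f x * G x y + F x y * g x"] conjI allI
         real_polynomial_function.intros(3,4) has_derivative_mult) simp_all
qed

lemma differentiable_has_derivative_grad:
  assumes "v differentiable (at x)"
  shows "(v has_derivative (\<lambda>y. grad v x *v y)) (at x)"
proof -
  have d: "(v has_derivative frechet_derivative v (at x)) (at x)"
    using assms by (simp add: frechet_derivative_works)
  then have "linear (frechet_derivative v (at x))" by (rule has_derivative_linear)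
  then have "(\<lambda>y. grad v x *v y) = frechet_derivative v (at x)"
    by (simp add: grad_def fun_eq_iff matrix_works)
  with d show ?thesis by simp
qed

lemma grad_unique: "(v has_derivative (\<lambda>y. M *v y)) (at x) \<Longrightarrow> grad v x = M"
  unfolding grad_def by (metis frechet_derivative_at matrix_of_matrix_vector_mul)

text \<open>Each entry of the Jacobian is the derivative of a component along a coordinate axis,
  hence a polynomial.\<close>

lemma continuous_on_grad_polynomial:
  fixes p :: "real^'d \<Rightarrow> real^'d"
  assumes "polynomial_function p"
  shows "continuous_on UNIV (grad p)"
proof -
  have "continuous_on UNIV (\<lambda>x. grad p x $ i $ j)" for i j
  proof -
    have "real_polynomial_function (\<lambda>x. p x $ i)"
      using assms bounded_linear_vec_nth[of i] by (auto simp: polynomial_function_def o_def)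
    then obtain D where D: "\<And>y. real_polynomial_function (\<lambda>x. D x y)"
      "\<And>x. ((\<lambda>x. p x $ i) has_derivative D x) (at x)"
      using real_polynomial_function_has_derivative by blast
    have "grad p x $ i $ j = D x (axis j 1)" for x
    proof -
      have "(p has_derivative (\<lambda>y. grad p x *v y)) (at x)"
        using assms by (intro differentiable_has_derivative_grad differentiable_at_polynomial_function)
      then have "((\<lambda>x. p x $ i) has_derivative (\<lambda>y. (grad p x *v y) $ i)) (at x)"
        by (rule bounded_linear.has_derivative[OF bounded_linear_vec_nth])
      then have "(\<lambda>y. (grad p x *v y) $ i) = D x"
        using D(2) by (rule has_derivative_unique)
      then have "D x (axis j 1) = (grad p x *v axis j 1) $ i" by metis
      then show ?thesis by (simp add: matrix_vector_mult_basis column_def)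
    qed
    then show ?thesis
      using continuous_on_polymonial_function[of "\<lambda>x. D x (axis j 1)" UNIV] D(1)
      by (simp add: real_polynomial_function_eq)
  qed
  then have "continuous_on UNIV (\<lambda>x. \<chi> i j. grad p x $ i $ j)"
    by (intro continuous_on_vec_lambda)
  then show ?thesis by simp
qed

section \<open>Mesh skeleton, Jacobians and extension by zero\<close>

locale polyhedral_mesh =
  fixes \<Omega> :: "(real^'d) set" and h :: real and \<T> :: "(real^'d) set set"
  assumes domain: "polyhedral_domain \<Omega>" and mesh: "is_mesh \<Omega> h \<T>"
begin

text \<open>The open set on which all piecewise polynomials are classically differentiable; it fills
  \<Omega> up to a null set.\<close>

definition U :: "(real^'d) set" where "U = \<Union>(interior ` \<T>)"

lemma finite_mesh: "finite \<T>" using mesh by (simp add: is_mesh_def)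

lemma mesh_simplex: "T \<in> \<T> \<Longrightarrow> convex T \<and> compact T \<and> closed T"
  using mesh by (auto simp: is_mesh_def intro: convex_simplex compact_simplex closed_simplex)

lemma Union_mesh: "\<Union>\<T> = closure \<Omega>" using mesh by (simp add: is_mesh_def)

lemma open_dom: "open \<Omega>"
  using domain unfolding polyhedral_domain_def by (elim conjE)

lemma bounded_dom: "bounded \<Omega>"
  using domain unfolding polyhedral_domain_def by (elim conjE)

lemma interior_closure_dom: "interior (closure \<Omega>) = \<Omega>"
  using domain unfolding polyhedral_domain_def by (elim conjE) (rule sym)

lemma lmeasurable_dom: "\<Omega> \<in> lmeasurable"
  using open_dom bounded_dom by (simp add: lmeasurable_open)

text \<open>Regular openness of the domain enters here: the interior of an element lies in the
  interior of the closure of \<Omega>, which is \<Omega> itself.\<close>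

lemma U_subset: "U \<subseteq> \<Omega>"
proof -
  have "interior T \<subseteq> \<Omega>" if "T \<in> \<T>" for T
    using interior_mono[of T "closure \<Omega>"] that Union_mesh interior_closure_dom by auto
  then show ?thesis by (auto simp: U_def)
qed

lemma closure_minus_U: "x \<in> closure \<Omega> \<Longrightarrow> x \<notin> U \<Longrightarrow> x \<in> \<Union>(frontier ` \<T>)"
proof -
  assume x: "x \<in> closure \<Omega>" "x \<notin> U"
  then obtain T where T: "T \<in> \<T>" "x \<in> T" using Union_mesh by blast
  then have "x \<in> closure T" "x \<notin> interior T" using x closure_subset by (auto simp: U_def)
  then show ?thesis using T by (auto simp: frontier_def)
qed

lemma AE_U: "AE x in lebesgue_on \<Omega>. x \<in> U"
proof -
  have "\<Union>(frontier ` \<T>) \<in> null_sets lebesgue"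
    using finite_mesh mesh_simplex
    by (auto simp: negligible_convex_frontier simp flip: negligible_iff_null_sets intro!: negligible_Union)
  then have "AE x in lebesgue. x \<notin> \<Union>(frontier ` \<T>)" by (rule AE_not_in)
  then have "AE x in lebesgue. x \<in> \<Omega> \<longrightarrow> x \<in> U"
    by (rule eventually_mono) (use closure_minus_U closure_subset in blast)
  then show ?thesis
    using open_dom by (subst AE_restrict_space_iff) auto
qed

text \<open>On the mesh skeleton \<^const>\<open>grad\<close> is an arbitrary value wherever the function is not
  differentiable; \<open>jac\<close> replaces it there, and outside \<open>\<Omega>\<close>, by \<open>0\<close>.\<close>
definition jac :: "(real^'d \<Rightarrow> real^'d) \<Rightarrow> real^'d \<Rightarrow> real^'d^'d" where
  "jac v x = (if x \<in> U then grad v x else 0)"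

lemma AE_grad_eq_jac: "AE x in lebesgue_on \<Omega>. grad v x = jac v x"
  using AE_U by (rule eventually_mono) (simp add: jac_def)

lemma pw_poly_local:
  assumes "pw_poly \<Omega> \<T> v" "T \<in> \<T>" "x \<in> interior T"
    and p: "polynomial_function p" "\<forall>x\<in>T. v x = p x"
  shows "(v has_derivative (\<lambda>y. grad p x *v y)) (at x)" "grad v x = grad p x"
proof -
  have "(p has_derivative (\<lambda>y. grad p x *v y)) (at x)"
    using p by (intro differentiable_has_derivative_grad differentiable_at_polynomial_function)
  then show "(v has_derivative (\<lambda>y. grad p x *v y)) (at x)"
    by (rule has_derivative_transform_within_open[where s="interior T"])
       (use assms interior_subset[of T] in auto)
  then show "grad v x = grad p x" by (rule grad_unique)
qed

lemma has_derivative_grad: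
  assumes "pw_poly \<Omega> \<T> v" "x \<in> U"
  shows "(v has_derivative (\<lambda>y. grad v x *v y)) (at x)"
proof -
  obtain T p where "T \<in> \<T>" "x \<in> interior T" "polynomial_function p" "\<forall>x\<in>T. v x = p x"
    using assms by (auto simp: U_def pw_poly_def)
  from pw_poly_local[OF assms(1) this] show ?thesis by simp
qed

text \<open>Elements are added one at a time. On the interior of an element the gradient is that of
  a polynomial, hence continuous, and gluing along an open set preserves Borel
  measurability.\<close>

lemma jac_measurable:
  assumes v: "pw_poly \<Omega> \<T> v"
  shows "jac v \<in> borel_measurable borel"
proof -
  have "(\<lambda>x. if x \<in> \<Union>(interior ` \<S>) then grad v x else 0) \<in> borel_measurable borel"
    if "finite \<S>" "\<S> \<subseteq> \<T>" for \<S> using that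
  proof (induction \<S> rule: finite_induct)
    case (insert T \<S>)
    then obtain p where p: "polynomial_function p" "\<forall>x\<in>T. v x = p x"
      using v by (auto simp: pw_poly_def)
    have [measurable]: "grad p \<in> borel_measurable borel"
      using continuous_on_grad_polynomial[OF p(1)] by (rule borel_measurable_continuous_onI)
    have IH: "(\<lambda>x. if x \<in> \<Union>(interior ` \<S>) then grad v x else 0) \<in> borel_measurable borel"
      using insert by auto
    have "(\<lambda>x. if x \<in> \<Union>(interior ` insert T \<S>) then grad v x else 0) =
      (\<lambda>x. if x \<in> interior T then grad p x else if x \<in> \<Union>(interior ` \<S>) then grad v x else 0)"
      using pw_poly_local(2)[OF v _ _ p] insert.prems by auto
    also have "\<dots> \<in> borel_measurable borel"
      by (rule measurable_If_set[OF _ IH]) auto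
    finally show ?case .
  qed simp
  from this[OF finite_mesh subset_refl] show ?thesis
    unfolding jac_def[abs_def] U_def .
qed

lemma jac_bounded:
  assumes v: "pw_poly \<Omega> \<T> v"
  obtains B where "\<And>x. norm (jac v x) \<le> B"
proof -
  have "\<exists>B. \<forall>x\<in>interior T. norm (grad v x) \<le> B" if T: "T \<in> \<T>" for T
  proof -
    obtain p where p: "polynomial_function p" "\<forall>x\<in>T. v x = p x"
      using v T by (auto simp: pw_poly_def)
    have "compact (grad p ` T)"
      using continuous_on_grad_polynomial[OF p(1)] mesh_simplex[OF T]
      by (intro compact_continuous_image) (auto intro: continuous_on_subset)
    then have "bounded (grad p ` T)" by (rule compact_imp_bounded)
    then obtain B where "\<forall>x\<in>T. norm (grad p x) \<le> B"
      by (auto simp: bounded_iff)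
    then show ?thesis
      using pw_poly_local(2)[OF v T _ p] interior_subset[of T] by (metis subsetD)
  qed
  then obtain B where B: "\<And>T x. T \<in> \<T> \<Longrightarrow> x \<in> interior T \<Longrightarrow> norm (grad v x) \<le> B T" by metis
  \<comment> \<open>The sum over the finite mesh dominates the bound of whichever element contains
    \<open>x\<close>; absolute values make every summand nonnegative.\<close>
  have "norm (jac v x) \<le> (\<Sum>T\<in>\<T>. \<bar>B T\<bar>)" for x
  proof (cases "x \<in> U")
    case True
    then obtain T where T: "T \<in> \<T>" "x \<in> interior T" by (auto simp: U_def)
    have "norm (jac v x) \<le> \<bar>B T\<bar>" using B[OF T] True by (simp add: jac_def)
    also have "\<dots> \<le> (\<Sum>T\<in>\<T>. \<bar>B T\<bar>)" using T finite_mesh by (intro member_le_sum) auto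
    finally show ?thesis .
  qed (simp add: jac_def sum_nonneg)
  then show thesis by (rule that)
qed

text \<open>Boundary values zero make this extension continuous on the whole space, so that it can
  be followed along lines that leave the domain.\<close>

definition ext :: "(real^'d \<Rightarrow> real^'d) \<Rightarrow> real^'d \<Rightarrow> real^'d" where
  "ext v x = (if x \<in> closure \<Omega> then v x else 0)"

lemma continuous_ext:
  assumes v: "pw_poly \<Omega> \<T> v"
  shows "continuous_on UNIV (ext v)"
proof -
  have "continuous_on (closure \<Omega> \<union> - \<Omega>) (ext v)"
    unfolding ext_def
  proof (rule continuous_on_If)
    show "continuous_on (closure \<Omega>) v" using v by (simp add: pw_poly_def)
    show "closed (- \<Omega>)" using open_dom by auto
  qed (use v open_dom closure_subset in \<open>auto simp: pw_poly_def frontier_def interior_open\<close>)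
  moreover have "closure \<Omega> \<union> - \<Omega> = UNIV" using closure_subset by blast
  ultimately show ?thesis by simp
qed

text \<open>Off the skeleton a point is either interior to an element or outside the closed domain;
  in the latter case \<open>ext v\<close> vanishes on a neighbourhood and \<open>jac v\<close> is 0
  by convention.\<close>

lemma ext_derivative:
  assumes v: "pw_poly \<Omega> \<T> v" and x: "x \<notin> \<Union>(frontier ` \<T>)"
  shows "(ext v has_derivative (\<lambda>y. jac v x *v y)) (at x)"
proof (cases "x \<in> closure \<Omega>")
  case True
  then have U: "x \<in> U" using closure_minus_U x by blast
  have "open U" by (auto simp: U_def)
  moreover have "U \<subseteq> closure \<Omega>" using U_subset closure_subset by blast
  ultimately have "(ext v has_derivative (\<lambda>y. grad v x *v y)) (at x)"
    using U by (intro has_derivative_transform_within_open[OF has_derivative_grad[OF v U]])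
      (auto simp: ext_def)
  then show ?thesis using U by (simp add: jac_def)
next
  case False
  then have "x \<notin> U" using U_subset closure_subset by blast
  moreover have "(ext v has_derivative (\<lambda>y. 0)) (at x)"
    by (rule has_derivative_transform_within_open[where f="\<lambda>_. 0" and s="- closure \<Omega>"])
       (use False in \<open>auto simp: ext_def\<close>)
  ultimately show ?thesis by (simp add: jac_def)
qed

text \<open>The function \<open>g\<close> may take arbitrary values on a null set. Completeness of
  Lebesgue measure transfers measurability to it from the Borel representative
  \<open>g'\<close>.\<close>

lemma ess_boundedI:
  fixes g g' :: "real^'d \<Rightarrow> 'b::euclidean_space"
  assumes [measurable]: "g' \<in> borel_measurable borel" and "\<And>x. norm (g' x) \<le> B"
    and ae: "AE x in lebesgue_on \<Omega>. g x = g' x"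
  shows "ess_bounded \<Omega> g"
  unfolding ess_bounded_def
proof (intro conjI exI)
  show "AE x in lebesgue_on \<Omega>. norm (g x) \<le> B"
    using ae by (rule eventually_mono) (use assms(2) in simp)
  have [measurable]: "\<Omega> \<in> sets borel" using open_dom by simp
  have "AE x in lebesgue. indicator \<Omega> x *\<^sub>R g' x = indicator \<Omega> x *\<^sub>R g x"
    using ae open_dom by (subst (asm) AE_restrict_space_iff) (auto elim!: eventually_mono simp: indicator_def)
  moreover have "(\<lambda>x. indicator \<Omega> x *\<^sub>R g' x) \<in> borel_measurable lebesgue"
    by (intro measurable_completion) measurable
  ultimately have "(\<lambda>x. indicator \<Omega> x *\<^sub>R g x) \<in> borel_measurable lebesgue"
    by (rule borel_measurable_AE[rotated])
  then show "g \<in> borel_measurable (lebesgue_on \<Omega>)"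
    using open_dom by (subst borel_measurable_restrict_space_iff) auto
qed

lemma ext_bounded:
  assumes v: "pw_poly \<Omega> \<T> v"
  obtains B where "\<And>x. norm (ext v x) \<le> B"
proof -
  have "compact (v ` closure \<Omega>)"
    using v bounded_dom by (intro compact_continuous_image) (auto simp: pw_poly_def)
  then have "bounded (v ` closure \<Omega>)" by (rule compact_imp_bounded)
  then obtain B where "\<forall>x\<in>closure \<Omega>. norm (v x) \<le> B"
    by (auto simp: bounded_iff)
  then have "norm (ext v x) \<le> max B 0" for x by (auto simp: ext_def le_max_iff_disj)
  then show thesis by (rule that)
qed

lemma AE_ext: "AE x in lebesgue_on \<Omega>. v x = ext v x"
  using closure_subset by (intro AE_I2) (auto simp: ext_def space_restrict_space)

lemma ess_bounded_pw_poly: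
  assumes v: "pw_poly \<Omega> \<T> v" shows "ess_bounded \<Omega> v"
  using ext_bounded[OF v] ess_boundedI[OF borel_measurable_continuous_onI[OF continuous_ext[OF v]] _ AE_ext]
  by blast

lemma ess_bounded_grad:
  assumes v: "pw_poly \<Omega> \<T> v" shows "ess_bounded \<Omega> (grad v)"
  using jac_bounded[OF v] ess_boundedI[OF jac_measurable[OF v] _ AE_grad_eq_jac] by blast

end

subsection \<open>The inner product of essentially bounded functions\<close>

text \<open>Each of the d diagonal entries is at most the Frobenius norm. This is the origin of the
  powers of d in the later constants.\<close>

lemma abs_trace_le:
  fixes M :: "real^'d^'d"
  shows "\<bar>trace M\<bar> \<le> real CARD('d) * norm M"
proof -
  have "\<bar>trace M\<bar> \<le> (\<Sum>i\<in>UNIV. \<bar>M $ i $ i\<bar>)"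
    unfolding trace_def by (rule sum_abs)
  also have "\<dots> \<le> (\<Sum>i\<in>(UNIV::'d set). norm M)"
  proof (rule sum_mono)
    fix i
    have "\<bar>M $ i $ i\<bar> \<le> norm (M $ i)" by (rule component_le_norm_cart)
    also have "\<dots> \<le> norm M" 
      by (rule Finite_Cartesian_Product.norm_nth_le)
    finally show "\<bar>M $ i $ i\<bar> \<le> norm M" .
  qed
  finally show ?thesis by simp
qed

lemma trace_scaleR_sum:
  fixes M :: "nat \<Rightarrow> real^'d^'d"
  shows "trace (\<Sum>i\<in>I. a i *\<^sub>R M i) = (\<Sum>i\<in>I. a i *\<^sub>R trace (M i))"
  unfolding trace_def by (simp add: sum_component sum_distrib_left) (rule sum.swap)

lemma norm_mult_axis_le:
  fixes M :: "real^'n^'m"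
  shows "norm (M *v axis k 1) \<le> norm M"
  unfolding matrix_vector_mult_basis column_def norm_vec_def[of M]
  unfolding norm_vec_def[of "\<chi> i. M $ i $ k"]
  by (rule L2_set_mono) (auto simp: component_le_norm_cart)

lemma ess_bounded_sum:
  assumes "\<And>i. i < (N::nat) \<Longrightarrow> ess_bounded \<Omega> (g i)"
  shows "ess_bounded \<Omega> (\<lambda>x. \<Sum>i<N. a i *\<^sub>R g i x)"
proof -
  obtain B where B: "\<And>i. i < N \<Longrightarrow> AE x in lebesgue_on \<Omega>. norm (g i x) \<le> B i"
    using assms unfolding ess_bounded_def by metis
  have "AE x in lebesgue_on \<Omega>. \<forall>i\<in>{..<N}. norm (g i x) \<le> B i"
    using B by (intro AE_finite_allI) auto
  then have "AE x in lebesgue_on \<Omega>. norm (\<Sum>i<N. a i *\<^sub>R g i x) \<le> (\<Sum>i<N. \<bar>a i\<bar> * B i)"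
  proof (rule eventually_mono)
    fix x assume "\<forall>i\<in>{..<N}. norm (g i x) \<le> B i"
    then show "norm (\<Sum>i<N. a i *\<^sub>R g i x) \<le> (\<Sum>i<N. \<bar>a i\<bar> * B i)"
      by (intro order_trans[OF norm_sum] sum_mono) (auto intro: mult_left_mono)
  qed
  moreover have "(\<lambda>x. \<Sum>i<N. a i *\<^sub>R g i x) \<in> borel_measurable (lebesgue_on \<Omega>)"
    using assms by (intro borel_measurable_sum borel_measurable_scaleR) (auto simp: ess_bounded_def)
  ultimately show ?thesis unfolding ess_bounded_def by blast
qed

lemma L2ip_commute: "L2ip \<Omega> u v = L2ip \<Omega> v u"
  by (simp add: L2ip_def inner_commute)

lemma L2ip_nonneg: "0 \<le> L2ip \<Omega> u u"
  by (simp add: L2ip_def)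

lemma L2norm_nonneg: "0 \<le> L2norm \<Omega> u"
  by (simp add: L2norm_def L2ip_nonneg)

lemma L2norm_power2: "(L2norm \<Omega> u)\<^sup>2 = L2ip \<Omega> u u"
  by (simp add: L2norm_def L2ip_nonneg)

lemma ess_bounded_integrable_inner:
  assumes "\<Omega> \<in> lmeasurable" "ess_bounded \<Omega> u" "ess_bounded \<Omega> v"
  shows "integrable (lebesgue_on \<Omega>) (\<lambda>x. u x \<bullet> v x)"
proof -
  interpret finite_measure "lebesgue_on \<Omega>"
    using assms(1) by (rule finite_measure_lebesgue_on)
  obtain A B where A: "AE x in lebesgue_on \<Omega>. norm (u x) \<le> A" and B: "AE x in lebesgue_on \<Omega>. norm (v x) \<le> B"
    using assms unfolding ess_bounded_def by blast
  have "AE x in lebesgue_on \<Omega>. norm (u x \<bullet> v x) \<le> A * B"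
    using A B
  proof (rule eventually_elim2)
    fix x assume "norm (u x) \<le> A" "norm (v x) \<le> B"
    then have "norm (u x) * norm (v x) \<le> A * B"
      by (intro mult_mono) (auto intro: order_trans[OF norm_ge_zero])
    then show "norm (u x \<bullet> v x) \<le> A * B"
      using Cauchy_Schwarz_ineq2[of "u x" "v x"] by simp
  qed
  then show ?thesis
    using assms by (intro integrable_const_bound) (auto simp: ess_bounded_def)
qed

lemma L2ip_sum_left:
  assumes "\<Omega> \<in> lmeasurable" "\<And>i. i < (N::nat) \<Longrightarrow> ess_bounded \<Omega> (g i)" "ess_bounded \<Omega> w"
  shows "L2ip \<Omega> (\<lambda>x. \<Sum>i<N. a i *\<^sub>R g i x) w = (\<Sum>i<N. a i * L2ip \<Omega> (g i) w)"
proof -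
  have "L2ip \<Omega> (\<lambda>x. \<Sum>i<N. a i *\<^sub>R g i x) w = (LINT x|lebesgue_on \<Omega>. (\<Sum>i<N. a i * (g i x \<bullet> w x)))"
    by (simp add: L2ip_def inner_sum_left)
  also have "\<dots> = (\<Sum>i<N. LINT x|lebesgue_on \<Omega>. a i * (g i x \<bullet> w x))"
    using assms by (intro Bochner_Integration.integral_sum integrable_mult_right ess_bounded_integrable_inner) auto
  finally show ?thesis by (simp add: L2ip_def)
qed

lemma L2ip_cong_AE:
  assumes "AE x in lebesgue_on \<Omega>. u x = u' x" "ess_bounded \<Omega> u" "ess_bounded \<Omega> u'" "ess_bounded \<Omega> w"
  shows "L2ip \<Omega> u w = L2ip \<Omega> u' w"
  unfolding L2ip_def using assms
  by (intro integral_cong_AE borel_measurable_inner) (auto simp: ess_bounded_def elim!: eventually_mono)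

lemma L2_Cauchy_Schwarz:
  assumes "\<Omega> \<in> lmeasurable" "ess_bounded \<Omega> u" "ess_bounded \<Omega> v"
  shows "L2ip \<Omega> u v \<le> L2norm \<Omega> u * L2norm \<Omega> v"
proof -
  let ?a = "L2ip \<Omega> u u" and ?b = "L2ip \<Omega> u v" and ?c = "L2ip \<Omega> v v"
  have q: "0 \<le> ?a + 2 * t * ?b + t * t * ?c" for t
  proof -
    have i: "integrable (lebesgue_on \<Omega>) (\<lambda>x. u x \<bullet> u x)" "integrable (lebesgue_on \<Omega>) (\<lambda>x. u x \<bullet> v x)"
      "integrable (lebesgue_on \<Omega>) (\<lambda>x. v x \<bullet> v x)"
      using assms by (auto intro: ess_bounded_integrable_inner)
    have "0 \<le> (LINT x|lebesgue_on \<Omega>. (u x + t *\<^sub>R v x) \<bullet> (u x + t *\<^sub>R v x))" by simp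
    also have "\<dots> = (LINT x|lebesgue_on \<Omega>. u x \<bullet> u x + 2 * t * (u x \<bullet> v x) + t * t * (v x \<bullet> v x))"
      by (intro Bochner_Integration.integral_cong) (auto simp: inner_add_left inner_add_right inner_commute)
    also have "\<dots> = ?a + 2 * t * ?b + t * t * ?c"
      using i by (simp add: L2ip_def)
    finally show ?thesis .
  qed
  have "?b\<^sup>2 \<le> ?a * ?c"
  proof (cases "?c = 0")
    case True
    have "?b = 0"
    proof (rule ccontr)
      assume "?b \<noteq> 0"
      \<comment> \<open>With \<open>?c = 0\<close> the quadratic is affine in \<open>t\<close>, and
        this \<open>t\<close> gives it the value -1.\<close>
      then show False using q[of "- (?a + 1) / (2 * ?b)"] True L2ip_nonneg[of \<Omega> u]
        by (simp add: field_simps)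
    qed
    then show ?thesis by (simp add: True)
  next
    case False
    then have c: "0 < ?c" using L2ip_nonneg[of \<Omega> v] by simp
    \<comment> \<open>The value of the quadratic at its minimiser.\<close>
    have "0 \<le> ?a - ?b * ?b / ?c" using q[of "- ?b / ?c"] False by simp
    then show ?thesis using c by (simp add: field_simps power2_eq_square)
  qed
  then have "sqrt (?b\<^sup>2) \<le> sqrt (?a * ?c)" by (rule real_sqrt_le_mono)
  then show ?thesis by (simp add: L2norm_def real_sqrt_mult)
qed

lemma L2norm_le_of_AE:
  assumes "\<Omega> \<in> lmeasurable" "ess_bounded \<Omega> u" "ess_bounded \<Omega> w" "0 \<le> K"
    and ae: "AE x in lebesgue_on \<Omega>. norm (u x) \<le> K * norm (w x)"
  shows "L2norm \<Omega> u \<le> K * L2norm \<Omega> w"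
proof -
  have "L2ip \<Omega> u u \<le> (LINT x|lebesgue_on \<Omega>. K\<^sup>2 * (w x \<bullet> w x))"
    unfolding L2ip_def
  proof (rule integral_mono_AE)
    show "AE x in lebesgue_on \<Omega>. u x \<bullet> u x \<le> K\<^sup>2 * (w x \<bullet> w x)"
      using ae
    proof (rule eventually_mono)
      fix x assume "norm (u x) \<le> K * norm (w x)"
      then have "(norm (u x))\<^sup>2 \<le> (K * norm (w x))\<^sup>2" by (rule power_mono) simp
      then show "u x \<bullet> u x \<le> K\<^sup>2 * (w x \<bullet> w x)"
        by (simp add: power_mult_distrib power2_norm_eq_inner)
    qed
  qed (use assms in \<open>auto intro: ess_bounded_integrable_inner\<close>)
  also have "\<dots> = K\<^sup>2 * L2ip \<Omega> w w" by (simp add: L2ip_def)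
  finally have "sqrt (L2ip \<Omega> u u) \<le> sqrt (K\<^sup>2 * L2ip \<Omega> w w)" by (rule real_sqrt_le_mono)
  then show ?thesis using \<open>0 \<le> K\<close> by (simp add: L2norm_def real_sqrt_mult)
qed

context polyhedral_mesh
begin

text \<open>Bridge between two settings: the one-dimensional argument works with nonnegative
  integrals over the whole space for \<open>lborel\<close>, the inner product with Lebesgue measure
  on \<Omega>. The representative \<open>g'\<close> is Borel and vanishes outside \<Omega>.\<close>

lemma nn_integral_eq_L2ip:
  fixes g g' :: "real^'d \<Rightarrow> 'b::euclidean_space"
  assumes g: "ess_bounded \<Omega> g" and ae: "AE x in lebesgue_on \<Omega>. g x = g' x"
    and [measurable]: "g' \<in> borel_measurable borel" and zero: "\<And>x. x \<notin> \<Omega> \<Longrightarrow> g' x = 0"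
  shows "(\<integral>\<^sup>+x. ennreal ((norm (g' x))\<^sup>2) \<partial>lborel) = ennreal (L2ip \<Omega> g g)"
proof -
  have "(\<integral>\<^sup>+x. ennreal ((norm (g' x))\<^sup>2) \<partial>lborel) = (\<integral>\<^sup>+x. ennreal ((norm (g' x))\<^sup>2) \<partial>lebesgue)"
    by (simp add: nn_integral_completion)
  also have "\<dots> = (\<integral>\<^sup>+x. ennreal ((norm (g' x))\<^sup>2) * indicator \<Omega> x \<partial>lebesgue)"
    using zero by (intro nn_integral_cong) (auto simp: indicator_def)
  also have "\<dots> = (\<integral>\<^sup>+x. ennreal ((norm (g' x))\<^sup>2) \<partial>lebesgue_on \<Omega>)"
    using open_dom by (subst nn_integral_restrict_space) auto
  also have "\<dots> = (\<integral>\<^sup>+x. ennreal (g x \<bullet> g x) \<partial>lebesgue_on \<Omega>)"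
    using ae by (intro nn_integral_cong_AE) (auto elim!: eventually_mono simp: power2_norm_eq_inner)
  also have "\<dots> = ennreal (L2ip \<Omega> g g)"
    unfolding L2ip_def using ess_bounded_integrable_inner[OF lmeasurable_dom g g]
    by (rule nn_integral_eq_integral) simp
  finally show ?thesis .
qed

lemma ess_bounded_divg:
  assumes "pw_poly \<Omega> \<T> v"
  shows "ess_bounded \<Omega> (divg v)"
proof -
  from ess_bounded_grad[OF assms] obtain B where [measurable]: "grad v \<in> borel_measurable (lebesgue_on \<Omega>)"
    and B: "AE x in lebesgue_on \<Omega>. norm (grad v x) \<le> B" by (auto simp: ess_bounded_def)
  have "continuous_on UNIV (trace :: real^'d^'d \<Rightarrow> real)"
    unfolding trace_def[abs_def] by (intro continuous_intros)
  then have "(\<lambda>x. trace (grad v x)) \<in> borel_measurable (lebesgue_on \<Omega>)"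
    by (rule borel_measurable_continuous_on) measurable
  moreover have "AE x in lebesgue_on \<Omega>. norm (divg v x) \<le> real CARD('d) * B"
    using B
  proof (rule eventually_mono)
    fix x assume "norm (grad v x) \<le> B"
    then have "real CARD('d) * norm (grad v x) \<le> real CARD('d) * B" by (intro mult_left_mono) auto
    with abs_trace_le[of "grad v x"] show "norm (divg v x) \<le> real CARD('d) * B"
      unfolding divg_def real_norm_def by (rule order_trans)
  qed
  ultimately show ?thesis unfolding ess_bounded_def divg_def[abs_def] by blast
qed

lemma L2norm_divg_le:
  assumes "pw_poly \<Omega> \<T> v"
  shows "L2norm \<Omega> (divg v) \<le> real CARD('d) * L2norm \<Omega> (grad v)"
  using assms
  by (intro L2norm_le_of_AE lmeasurable_dom ess_bounded_divg ess_bounded_grad AE_I2)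
     (auto simp: divg_def abs_trace_le)

text \<open>The constant depends only on the radius of a ball around the origin containing \<Omega>,
  so it is the same for all meshes.\<close>

lemma poincare:
  assumes v: "pw_poly \<Omega> \<T> v" and r: "0 < r" "\<And>x. x \<in> \<Omega> \<Longrightarrow> norm x \<le> r"
  shows "L2norm \<Omega> v \<le> (2 * r + 1) * L2norm \<Omega> (grad v)"
proof -
  \<comment> \<open>If \<open>x\<close> and \<open>x + R *\<^sub>R e\<close> both had norm at most
    \<open>r\<close>, then \<open>R\<close> would be at most \<open>2 * r\<close>; the extra 1
    excludes this. The direction \<open>e\<close> is a coordinate axis with an arbitrary
    index.\<close>
  define R where "R = 2 * r + 1"
  define e :: "real^'d" where "e = axis undefined 1"
  have R: "0 < R" using r by (simp add: R_def)
  have e: "norm e = 1" by (simp add: e_def)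
  obtain B where B: "\<And>x. norm (jac v x) \<le> B" using jac_bounded[OF v] by blast
  have [measurable]: "jac v \<in> borel_measurable borel" by (rule jac_measurable[OF v])
  have ext0: "ext v x = 0" if "x \<notin> \<Omega>" for x
    using that v open_dom by (auto simp: ext_def pw_poly_def frontier_def interior_open)
  have mono: "norm (jac v x *v e) \<le> norm (jac v x)" for x
    unfolding e_def by (rule norm_mult_axis_le)
  have cont: "continuous_on UNIV (\<lambda>M :: real^'d^'d. M *v e)"
    unfolding matrix_vector_mult_def by (intro continuous_intros)
  have "ennreal (L2ip \<Omega> v v) = (\<integral>\<^sup>+x. ennreal ((norm (ext v x))\<^sup>2) \<partial>lborel)"
    using ess_bounded_pw_poly[OF v] AE_ext borel_measurable_continuous_onI[OF continuous_ext[OF v]] ext0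
    by (rule nn_integral_eq_L2ip[symmetric])
  also have "\<dots> \<le> ennreal (R\<^sup>2) * (\<integral>\<^sup>+x. ennreal ((norm (jac v x *v e))\<^sup>2) \<partial>lborel)"
  proof (rule poincare_along_direction[OF R continuous_ext[OF v] _ _ _ finite_mesh])
    fix x assume "ext v x \<noteq> 0"
    then have "norm x \<le> r" using ext0 r by blast
    have "R = norm (R *\<^sub>R e)" using e R by simp
    also have "\<dots> \<le> norm (x + R *\<^sub>R e) + norm x"
      using norm_triangle_ineq4[of "x + R *\<^sub>R e" x] by simp
    finally have "\<not> norm (x + R *\<^sub>R e) \<le> r" using \<open>norm x \<le> r\<close> r(1) unfolding R_def by linarith
    then show "ext v (x + R *\<^sub>R e) = 0" using ext0 r(2) by blast
  next
    show "(\<lambda>x. jac v x *v e) \<in> borel_measurable borel"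
      using cont by (rule borel_measurable_continuous_on) measurable
    show "norm (jac v x *v e) \<le> B" for x using mono B by (rule order_trans)
    show "convex T \<and> closed T" if "T \<in> \<T>" for T using mesh_simplex[OF that] by blast
  next
    fix x assume x: "x \<notin> \<Union>(frontier ` \<T>)"
    have "((\<lambda>t. x + t *\<^sub>R e) has_derivative (\<lambda>t. t *\<^sub>R e)) (at 0)"
      by (auto intro!: derivative_eq_intros)
    moreover have "(ext v has_derivative (\<lambda>y. jac v x *v y)) (at (x + 0 *\<^sub>R e))"
      using ext_derivative[OF v x] by simp
    ultimately have "(ext v \<circ> (\<lambda>t. x + t *\<^sub>R e) has_derivative (\<lambda>y. jac v x *v y) \<circ> (\<lambda>t. t *\<^sub>R e)) (at 0)"
      by (rule diff_chain_at)
    then show "((\<lambda>t. ext v (x + t *\<^sub>R e)) has_vector_derivative jac v x *v e) (at 0)"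
      by (simp add: has_vector_derivative_def o_def matrix_vector_mult_scaleR)
  qed
  also have "\<dots> \<le> ennreal (R\<^sup>2) * (\<integral>\<^sup>+x. ennreal ((norm (jac v x))\<^sup>2) \<partial>lborel)"
    using mono by (intro mult_left_mono nn_integral_mono ennreal_leI power_mono) auto
  also have "(\<integral>\<^sup>+x. ennreal ((norm (jac v x))\<^sup>2) \<partial>lborel) = ennreal (L2ip \<Omega> (grad v) (grad v))"
    using U_subset
    by (intro nn_integral_eq_L2ip ess_bounded_grad[OF v] AE_grad_eq_jac jac_measurable[OF v]) (auto simp: jac_def)
  also have "ennreal (R\<^sup>2) * \<dots> = ennreal (R\<^sup>2 * L2ip \<Omega> (grad v) (grad v))"
    by (simp add: ennreal_mult L2ip_nonneg)
  finally have "L2ip \<Omega> v v \<le> R\<^sup>2 * L2ip \<Omega> (grad v) (grad v)"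
    by (simp add: L2ip_nonneg)
  then have "sqrt (L2ip \<Omega> v v) \<le> sqrt (R\<^sup>2 * L2ip \<Omega> (grad v) (grad v))" by (rule real_sqrt_le_mono)
  then show ?thesis using R by (simp add: L2norm_def real_sqrt_mult R_def)
qed

end

subsection \<open>Norms and inverses of square matrices\<close>

text \<open>A singular matrix has a nonzero kernel vector, so injectivity gives a nonzero
  determinant and a two-sided inverse. Existence is what gives meaning to the choice made by
  \<open>matinv\<close>.\<close>

lemma ex_inverse_matrix:
  fixes M :: "nat \<Rightarrow> nat \<Rightarrow> real"
  assumes inj: "\<And>a i. (\<And>i. i < N \<Longrightarrow> mvmult N M a i = 0) \<Longrightarrow> i < N \<Longrightarrow> a i = 0"
  shows "\<exists>B. \<forall>i<N. \<forall>j<N. mmult N B M i j = (if i = j then 1 else 0) \<and> mmult N M B i j = (if i = j then 1 else 0)"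
proof -
  define A where "A = Matrix.mat N N (\<lambda>(i, j). M i j)"
  have A: "A \<in> carrier_mat N N" by (simp add: A_def)
  have "Determinant.det A \<noteq> 0"
  proof
    assume "Determinant.det A = 0"
    then obtain v where v: "v \<in> carrier_vec N" "v \<noteq> 0\<^sub>v N" "A *\<^sub>v v = 0\<^sub>v N"
      using det_0_iff_vec_prod_zero_field[OF A] by blast
    have "mvmult N M (vec_index v) i = 0" if "i < N" for i
    proof -
      have "mvmult N M (vec_index v) i = vec_index (A *\<^sub>v v) i"
        using that v(1) by (simp add: A_def mvmult_def scalar_prod_def lessThan_atLeast0)
      then show ?thesis using that v(3) by simp
    qed
    then have "vec_index v i = 0" if "i < N" for i using inj that by blast
    then have "v = 0\<^sub>v N" using v(1) by (intro eq_vecI) auto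
    with v(2) show False ..
  qed
  then obtain B where B: "B \<in> carrier_mat N N" "B * A = 1\<^sub>m N" "A * B = 1\<^sub>m N"
    using det_non_zero_imp_unit[OF A, of undefined] by (auto simp: Units_def ring_mat_def)
  have "mmult N (\<lambda>i j. B $$ (i, j)) M i j = (B * A) $$ (i, j)"
    "mmult N M (\<lambda>i j. B $$ (i, j)) i j = (A * B) $$ (i, j)" if "i < N" "j < N" for i j
    using that B(1) by (simp_all add: A_def mmult_def scalar_prod_def lessThan_atLeast0)
  then show ?thesis using B by (intro exI[of _ "\<lambda>i j. B $$ (i, j)"]) simp
qed

lemma mvmult_mmult: "mvmult N (mmult N M P) a i = mvmult N M (mvmult N P a) i"
proof -
  have "mvmult N (mmult N M P) a i = (\<Sum>j<N. \<Sum>k<N. M i k * (P k j * a j))"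
    by (simp add: mvmult_def mmult_def sum_distrib_right mult.assoc)
  also have "\<dots> = (\<Sum>k<N. \<Sum>j<N. M i k * (P k j * a j))" by (rule sum.swap)
  finally show ?thesis by (simp add: mvmult_def sum_distrib_left)
qed

lemma mvmult_cong: "(\<And>i. i < N \<Longrightarrow> a i = b i) \<Longrightarrow> mvmult N M a = mvmult N M b"
  by (simp add: mvmult_def fun_eq_iff)

lemma matinv_mvmult:
  assumes inj: "\<And>a i. (\<And>i. i < N \<Longrightarrow> mvmult N M a i = 0) \<Longrightarrow> i < N \<Longrightarrow> a i = 0"
    and "i < N"
  shows "mvmult N (matinv N M) (mvmult N M a) i = a i" "mvmult N M (mvmult N (matinv N M) a) i = a i"
proof -
  have ex: "\<exists>B. \<forall>i<N. \<forall>j<N. mmult N B M i j = (if i = j then 1 else 0) \<and> mmult N M B i j = (if i = j then 1 else 0)"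
    using inj by (rule ex_inverse_matrix)
  have "mmult N (matinv N M) M i j = (if i = j then 1 else 0)" "mmult N M (matinv N M) i j = (if i = j then 1 else 0)"
    if "j < N" for j
    using someI_ex[OF ex] that \<open>i < N\<close> unfolding matinv_def by auto
  then have "mvmult N (mmult N (matinv N M) M) a i = (\<Sum>j<N. (if i = j then 1 else 0) * a j)"
    "mvmult N (mmult N M (matinv N M)) a i = (\<Sum>j<N. (if i = j then 1 else 0) * a j)"
    unfolding mvmult_def by (auto intro!: sum.cong)
  then show "mvmult N (matinv N M) (mvmult N M a) i = a i" "mvmult N M (mvmult N (matinv N M) a) i = a i"
    using \<open>i < N\<close> by (simp_all add: mvmult_mmult if_distrib[of "\<lambda>x. x * _"] cong: if_cong)
qed

section \<open>Euclidean vector norm and induced matrix norm\<close>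

lemma vnorm_eq_L2_set: "vnorm N a = L2_set a {..<N}"
  by (simp add: vnorm_def L2_set_def)

lemma vnorm_nonneg: "0 \<le> vnorm N a"
  by (simp add: vnorm_def sum_nonneg)

lemma vnorm_power2: "(vnorm N a)\<^sup>2 = (\<Sum>i<N. (a i)\<^sup>2)"
  by (simp add: vnorm_def sum_nonneg)

lemma vnorm_eq_0_iff: "vnorm N a = 0 \<longleftrightarrow> (\<forall>i<N. a i = 0)"
  by (auto simp: vnorm_eq_L2_set L2_set_eq_0_iff)

lemma vnorm_scale: "vnorm N (\<lambda>i. s * a i) = \<bar>s\<bar> * vnorm N a"
  by (simp add: vnorm_def power_mult_distrib real_sqrt_mult flip: sum_distrib_left)

lemma vnorm_Cauchy_Schwarz: "(\<Sum>i<N. a i * b i) \<le> vnorm N a * vnorm N b"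
proof -
  have "(\<Sum>i<N. a i * b i) \<le> (\<Sum>i<N. \<bar>a i\<bar> * \<bar>b i\<bar>)"
    by (intro sum_mono) (simp flip: abs_mult)
  also have "\<dots> \<le> vnorm N a * vnorm N b" unfolding vnorm_eq_L2_set by (rule L2_set_mult_ineq)
  finally show ?thesis .
qed

lemma mvmult_scale: "mvmult N M (\<lambda>i. s * a i) = (\<lambda>i. s * mvmult N M a i)"
  by (simp add: mvmult_def fun_eq_iff sum_distrib_left mult_ac)

text \<open>The constant is the Frobenius norm of \<open>M\<close>. The estimate makes the supremum
  in \<open>matnorm\<close> a supremum of a bounded set.\<close>

lemma vnorm_mvmult_le_frobenius: "vnorm N (mvmult N M a) \<le> vnorm N (\<lambda>i. vnorm N (M i)) * vnorm N a"
proof -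
  have "\<bar>mvmult N M a i\<bar> \<le> vnorm N (M i) * vnorm N a" for i
    unfolding mvmult_def using vnorm_Cauchy_Schwarz[of "M i" a N] vnorm_Cauchy_Schwarz[of "\<lambda>j. - M i j" a N]
    by (simp add: vnorm_def sum_negf)
  then have "vnorm N (mvmult N M a) \<le> vnorm N (\<lambda>i. vnorm N a * vnorm N (M i))"
    unfolding vnorm_def[of N "mvmult N M a"] vnorm_def[of N "\<lambda>i. vnorm N a * vnorm N (M i)"]
    by (intro real_sqrt_le_mono sum_mono) (metis abs_ge_zero mult.commute power2_abs power_mono)
  then show ?thesis by (simp add: vnorm_scale vnorm_nonneg mult.commute)
qed

lemma vnorm_unit: "0 < N \<Longrightarrow> vnorm N (\<lambda>i. if i = 0 then 1 else 0) = 1"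
  by (simp add: vnorm_def if_distrib[of "\<lambda>x. x\<^sup>2"] cong: if_cong)

lemma bdd_above_matnorm: "bdd_above {vnorm N (mvmult N M a) | a. vnorm N a = 1}"
proof (rule bdd_aboveI)
  fix x assume "x \<in> {vnorm N (mvmult N M a) | a. vnorm N a = 1}"
  then obtain a where "x = vnorm N (mvmult N M a)" "vnorm N a = 1" by blast
  then show "x \<le> vnorm N (\<lambda>i. vnorm N (M i))" using vnorm_mvmult_le_frobenius[of N M a] by simp
qed

lemma vnorm_mvmult_le: "vnorm N (mvmult N M a) \<le> matnorm N M * vnorm N a"
proof (cases "vnorm N a = 0")
  case True
  \<comment> \<open>A vector of length zero cannot be normalised; here the Frobenius estimate forces
    its image to have length zero.\<close>
  then show ?thesis using vnorm_mvmult_le_frobenius[of N M a] by simp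
next
  case False
  then have pos: "0 < vnorm N a" using vnorm_nonneg[of N a] by simp
  let ?b = "\<lambda>i. inverse (vnorm N a) * a i"
  have "vnorm N ?b = 1" using pos by (simp add: vnorm_scale)
  then have "vnorm N (mvmult N M ?b) \<le> matnorm N M"
    unfolding matnorm_def by (intro cSup_upper bdd_above_matnorm) blast
  then have "inverse (vnorm N a) * vnorm N (mvmult N M a) \<le> matnorm N M"
    using pos by (simp add: mvmult_scale vnorm_scale)
  then show ?thesis using pos by (simp add: field_simps)
qed

lemma matnorm_le:
  assumes "0 < N" "\<And>a. vnorm N (mvmult N M a) \<le> K * vnorm N a"
  shows "matnorm N M \<le> K"
  unfolding matnorm_def
proof (rule cSup_least)
  show "{vnorm N (mvmult N M a) |a. vnorm N a = 1} \<noteq> {}"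
    using vnorm_unit[OF \<open>0 < N\<close>] by blast
  fix x assume "x \<in> {vnorm N (mvmult N M a) |a. vnorm N a = 1}"
  then obtain a where "x = vnorm N (mvmult N M a)" "vnorm N a = 1" by blast
  then show "x \<le> K" using assms(2)[of a] by simp
qed

lemma matnorm_nonneg: "0 < N \<Longrightarrow> 0 \<le> matnorm N M"
  using vnorm_mvmult_le[of N M "\<lambda>i. if i = 0 then 1 else 0"] vnorm_unit[of N]
    vnorm_nonneg[of N "mvmult N M (\<lambda>i. if i = 0 then 1 else 0)"] by simp

text \<open>Compactness of the unit sphere. Coefficient vectors are functions on all natural
  numbers, so the coordinates from \<open>N\<close> on are pinned to 0 and the others confined to
  [-1, 1]; this box is a product of compact factors.\<close>

lemma matnorm_attained:
  assumes "0 < N"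
  obtains a where "vnorm N a = 1" "vnorm N (mvmult N M a) = matnorm N M"
proof -
  define box :: "(nat \<Rightarrow> real) set" where "box = PiE UNIV (\<lambda>i. if i < N then {-1..1} else {0})"
  define S where "S = box \<inter> {a. vnorm N a = 1}"
  have "compactin (product_topology (\<lambda>_. euclidean) UNIV) box"
    unfolding box_def by (subst compactin_PiE) auto
  then have "compact box" by (simp add: euclidean_product_topology)
  moreover have cont: "continuous_on UNIV (\<lambda>a :: nat \<Rightarrow> real. vnorm N a)"
    unfolding vnorm_def by (intro continuous_intros) auto
  then have "closed {a. vnorm N a = 1}"
    by (rule closed_Collect_eq) auto
  ultimately have "compact S" unfolding S_def by (rule compact_Int_closed)
  \<comment> \<open>Truncation to the first \<open>N\<close> coordinates moves any unit vector into
    \<open>S\<close> and changes neither its length nor its image under \<open>M\<close>, so a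
    maximum over \<open>S\<close> is a maximum over all unit vectors.\<close>
  moreover have restr: "(\<lambda>i. if i < N then a i else 0) \<in> S" if "vnorm N a = 1" for a
  proof -
    have "\<bar>a i\<bar> \<le> 1" if "i < N" for i
      using member_le_L2_set[of "{..<N}" i "\<lambda>i. \<bar>a i\<bar>"] that \<open>vnorm N a = 1\<close>
      by (simp add: vnorm_def L2_set_def)
    moreover have "vnorm N (\<lambda>i. if i < N then a i else 0) = 1"
      using that by (simp add: vnorm_def)
    ultimately show ?thesis by (auto simp: S_def box_def PiE_iff abs_le_iff minus_le_iff)
  qed
  then have "S \<noteq> {}" using vnorm_unit[OF assms] by (metis empty_iff)
  moreover have "continuous_on S (\<lambda>a. vnorm N (mvmult N M a))"
    unfolding vnorm_def mvmult_def
    by (rule continuous_on_subset[OF _ subset_UNIV]) (intro continuous_intros; auto)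
  ultimately have "\<exists>a\<in>S. \<forall>b\<in>S. vnorm N (mvmult N M b) \<le> vnorm N (mvmult N M a)"
    by (rule continuous_attains_sup)
  then obtain a where a: "a \<in> S" "\<forall>b\<in>S. vnorm N (mvmult N M b) \<le> vnorm N (mvmult N M a)" by blast
  have "matnorm N M \<le> vnorm N (mvmult N M a)"
    unfolding matnorm_def
  proof (rule cSup_least)
    show "{vnorm N (mvmult N M a) |a. vnorm N a = 1} \<noteq> {}"
      using vnorm_unit[OF \<open>0 < N\<close>] by blast
    fix x assume "x \<in> {vnorm N (mvmult N M a) |a. vnorm N a = 1}"
    then obtain b where b: "vnorm N b = 1" "x = vnorm N (mvmult N M b)" by blast
    have "mvmult N M (\<lambda>i. if i < N then b i else 0) = mvmult N M b" by (rule mvmult_cong) simp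
    then show "x \<le> vnorm N (mvmult N M a)" using bspec[OF a(2) restr[OF b(1)]] b(2) by simp
  qed
  moreover have "vnorm N a = 1" using a(1) by (simp add: S_def)
  ultimately show thesis
    using that[of a] vnorm_mvmult_le[of N M a] by simp
qed

subsection \<open>The penalty matrix\<close>

text \<open>A single mesh size. The constants \<open>r\<close>, \<open>C1\<close>, \<open>c1\<close>
  and \<open>c2\<close> will be the same for all members of the family, so uniformity in h and
  \<epsilon> is obtained by keeping every constant explicit in them and in d.\<close>

locale penalty_fem = polyhedral_mesh \<Omega> h \<T>
  for \<Omega> :: "(real^'d) set" and h :: real and \<T> :: "(real^'d) set set" +
  fixes N :: nat and \<phi> :: "nat \<Rightarrow> real^'d \<Rightarrow> real^'d" and r C1 c1 c2 :: real
  assumes N_pos: "0 < N" and h_pos: "0 < h"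
    and basis: "\<And>i. i < N \<Longrightarrow> pw_poly \<Omega> \<T> (\<phi> i)"
    and r_pos: "0 < r" and dom_le: "\<And>x. x \<in> \<Omega> \<Longrightarrow> norm x \<le> r"
    and C1_nonneg: "0 \<le> C1"
    and inverse_estimate: "\<And>a. L2norm \<Omega> (grad (fe_fun N \<phi> a)) \<le> C1 * inverse h * L2norm \<Omega> (fe_fun N \<phi> a)"
    and c1_pos: "0 < c1" and c2_pos: "0 < c2"
    and vnorm_le_L2norm: "\<And>a. c1 * (vnorm N a / sqrt (real N)) \<le> L2norm \<Omega> (fe_fun N \<phi> a)"
    and L2norm_le_vnorm: "\<And>a. L2norm \<Omega> (fe_fun N \<phi> a) \<le> c2 * (vnorm N a / sqrt (real N))"
begin

abbreviation F :: "(nat \<Rightarrow> real) \<Rightarrow> real^'d \<Rightarrow> real^'d" where "F \<equiv> fe_fun N \<phi>"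

abbreviation A :: "real \<Rightarrow> nat \<Rightarrow> nat \<Rightarrow> real" where "A \<equiv> penalty_matrix \<Omega> \<phi>"

definition energy :: "real \<Rightarrow> (nat \<Rightarrow> real) \<Rightarrow> (nat \<Rightarrow> real) \<Rightarrow> real" where
  "energy \<epsilon> b a = L2ip \<Omega> (grad (F b)) (grad (F a)) + inverse \<epsilon> * L2ip \<Omega> (divg (F b)) (divg (F a))"

lemma fe_space_eq: "fe_space N \<phi> = range F"
  by (auto simp: fe_space_def fe_fun_def)

lemma F_unit: "j < N \<Longrightarrow> F (\<lambda>i. if i = j then 1 else 0) = \<phi> j"
  by (simp add: fe_fun_def if_distrib[of "\<lambda>x. x *\<^sub>R _"] cong: if_cong)

lemma pw_poly_F: "pw_poly \<Omega> \<T> (F a)"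
  unfolding pw_poly_def
proof (intro conjI ballI)
  show "continuous_on (closure \<Omega>) (F a)"
    using basis unfolding fe_fun_def by (intro continuous_intros) (auto simp: pw_poly_def)
  show "F a x = 0" if "x \<in> frontier \<Omega>" for x
    using basis that by (auto simp: fe_fun_def pw_poly_def)
  fix T assume T: "T \<in> \<T>"
  then have "\<exists>p. polynomial_function p \<and> (\<forall>x\<in>T. \<phi> i x = p x)" if "i < N" for i
    using basis[OF that] by (simp add: pw_poly_def)
  then obtain p where p: "\<And>i. i < N \<Longrightarrow> polynomial_function (p i) \<and> (\<forall>x\<in>T. \<phi> i x = p i x)"
    by metis
  show "\<exists>p. polynomial_function p \<and> (\<forall>x\<in>T. F a x = p x)"
  proof (intro exI conjI ballI)
    show "polynomial_function (\<lambda>x. \<Sum>i<N. a i *\<^sub>R p i x)"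
      using p by (intro polynomial_function_sum polynomial_function_cmul) auto
    show "F a x = (\<Sum>i<N. a i *\<^sub>R p i x)" if "x \<in> T" for x
      using p that by (auto simp: fe_fun_def intro!: sum.cong)
  qed
qed

text \<open>Linearity of \<open>grad\<close> is claimed only on \<open>U\<close>, where all basis
  functions are differentiable; almost everywhere is enough under the integral.\<close>

lemma grad_F:
  assumes "x \<in> U"
  shows "grad (F a) x = (\<Sum>i<N. a i *\<^sub>R grad (\<phi> i) x)"
proof (rule grad_unique)
  have "(F a has_derivative (\<lambda>y. \<Sum>i<N. a i *\<^sub>R (grad (\<phi> i) x *v y))) (at x)"
    unfolding fe_fun_def using basis assms
    by (intro has_derivative_sum has_derivative_scaleR_right has_derivative_grad) auto
  moreover have "(\<Sum>i<N. a i *\<^sub>R (grad (\<phi> i) x *v y)) = (\<Sum>i<N. a i *\<^sub>R grad (\<phi> i) x) *v y" for y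
  proof -
    have "linear (\<lambda>M :: real^'d^'d. M *v y)"
      by (rule linearI) (simp_all add: matrix_vector_mult_add_rdistrib scaleR_matrix_vector_assoc)
    then show ?thesis by (simp add: linear_sum[where f="\<lambda>M :: real^'d^'d. M *v y"] scaleR_matrix_vector_assoc)
  qed
  ultimately show "(F a has_derivative (\<lambda>y. (\<Sum>i<N. a i *\<^sub>R grad (\<phi> i) x) *v y)) (at x)" by simp
qed

lemma L2ip_F_left: "ess_bounded \<Omega> w \<Longrightarrow> L2ip \<Omega> (F b) w = (\<Sum>i<N. b i * L2ip \<Omega> (\<phi> i) w)"
  unfolding fe_fun_def
  by (rule L2ip_sum_left[OF lmeasurable_dom]) (simp_all add: ess_bounded_pw_poly basis)

lemma L2ip_grad_F_left:
  assumes w: "ess_bounded \<Omega> w"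
  shows "L2ip \<Omega> (grad (F b)) w = (\<Sum>i<N. b i * L2ip \<Omega> (grad (\<phi> i)) w)"
proof -
  have "L2ip \<Omega> (grad (F b)) w = L2ip \<Omega> (\<lambda>x. \<Sum>i<N. b i *\<^sub>R grad (\<phi> i) x) w"
  proof (rule L2ip_cong_AE[OF _ ess_bounded_grad[OF pw_poly_F] ess_bounded_sum[OF ess_bounded_grad[OF basis]] w])
    show "AE x in lebesgue_on \<Omega>. grad (F b) x = (\<Sum>i<N. b i *\<^sub>R grad (\<phi> i) x)"
      using AE_U by (rule eventually_mono) (rule grad_F)
  qed
  then show ?thesis
    using L2ip_sum_left[OF lmeasurable_dom ess_bounded_grad[OF basis] w] by simp
qed

lemma L2ip_divg_F_left:
  assumes w: "ess_bounded \<Omega> w"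
  shows "L2ip \<Omega> (divg (F b)) w = (\<Sum>i<N. b i * L2ip \<Omega> (divg (\<phi> i)) w)"
proof -
  have "L2ip \<Omega> (divg (F b)) w = L2ip \<Omega> (\<lambda>x. \<Sum>i<N. b i *\<^sub>R divg (\<phi> i) x) w"
  proof (rule L2ip_cong_AE[OF _ ess_bounded_divg[OF pw_poly_F] ess_bounded_sum[OF ess_bounded_divg[OF basis]] w])
    show "AE x in lebesgue_on \<Omega>. divg (F b) x = (\<Sum>i<N. b i *\<^sub>R divg (\<phi> i) x)"
      using AE_U by (rule eventually_mono) (simp add: divg_def grad_F trace_scaleR_sum)
  qed
  then show ?thesis
    using L2ip_sum_left[OF lmeasurable_dom ess_bounded_divg[OF basis] w] by simp
qed

lemma mvmult_A:
  assumes "i < N"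
  shows "mvmult N (A \<epsilon>) a i = L2ip \<Omega> (grad (\<phi> i)) (grad (F a)) + inverse \<epsilon> * L2ip \<Omega> (divg (\<phi> i)) (divg (F a))"
proof -
  have "mvmult N (A \<epsilon>) a i = (\<Sum>j<N. a j * L2ip \<Omega> (grad (\<phi> j)) (grad (\<phi> i)) +
      inverse \<epsilon> * (a j * L2ip \<Omega> (divg (\<phi> j)) (divg (\<phi> i))))"
    unfolding mvmult_def penalty_matrix_def
    by (intro sum.cong refl) (simp add: L2ip_commute distrib_left mult_ac)
  also have "\<dots> = L2ip \<Omega> (grad (F a)) (grad (\<phi> i)) + inverse \<epsilon> * L2ip \<Omega> (divg (F a)) (divg (\<phi> i))"
    unfolding L2ip_grad_F_left[OF ess_bounded_grad[OF basis[OF assms]]]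
      L2ip_divg_F_left[OF ess_bounded_divg[OF basis[OF assms]]]
    by (simp only: sum.distrib sum_distrib_left)
  finally show ?thesis by (simp only: L2ip_commute[of \<Omega> "grad (F a)"] L2ip_commute[of \<Omega> "divg (F a)"])
qed

lemma sum_mvmult_A: "(\<Sum>i<N. b i * mvmult N (A \<epsilon>) a i) = energy \<epsilon> b a"
proof -
  have "(\<Sum>i<N. b i * mvmult N (A \<epsilon>) a i) = (\<Sum>i<N. b i * L2ip \<Omega> (grad (\<phi> i)) (grad (F a)) +
      inverse \<epsilon> * (b i * L2ip \<Omega> (divg (\<phi> i)) (divg (F a))))"
    by (intro sum.cong refl) (simp add: mvmult_A distrib_left mult_ac)
  also have "\<dots> = energy \<epsilon> b a"
    unfolding energy_def L2ip_grad_F_left[OF ess_bounded_grad[OF pw_poly_F]]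
      L2ip_divg_F_left[OF ess_bounded_divg[OF pw_poly_F]]
    by (simp only: sum.distrib sum_distrib_left)
  finally show ?thesis .
qed

section \<open>Bounds for the energy form, the matrix and its inverse\<close>

lemma energy_commute: "energy \<epsilon> b a = energy \<epsilon> a b"
  by (simp add: energy_def L2ip_commute)

text \<open>The estimate is deliberately asymmetric: the inverse estimate and the norm equivalence
  are spent on the test vector \<open>b\<close> alone. The gradient and divergence norms of
  \<open>F a\<close> survive, which serves both the bound of |A| and the bound that retains the
  divergence of the solution.\<close>

lemma energy_le:
  assumes "0 < \<epsilon>"
  shows "energy \<epsilon> b a \<le> C1 * inverse h * c2 / sqrt (real N) * vnorm N b *
    (L2norm \<Omega> (grad (F a)) + real CARD('d) * inverse \<epsilon> * L2norm \<Omega> (divg (F a)))"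
proof -
  let ?G = "\<lambda>a. L2norm \<Omega> (grad (F a))" and ?D = "\<lambda>a. L2norm \<Omega> (divg (F a))"
  note nn = L2norm_nonneg[of \<Omega> "grad (F a)"] L2norm_nonneg[of \<Omega> "divg (F a)"] L2norm_nonneg[of \<Omega> "grad (F b)"]
  have "energy \<epsilon> b a \<le> ?G b * ?G a + inverse \<epsilon> * (?D b * ?D a)"
    unfolding energy_def using assms
    by (intro add_mono mult_left_mono L2_Cauchy_Schwarz lmeasurable_dom ess_bounded_grad ess_bounded_divg pw_poly_F) auto
  also have "\<dots> \<le> ?G b * ?G a + inverse \<epsilon> * ((real CARD('d) * ?G b) * ?D a)"
    using assms nn by (intro add_left_mono mult_left_mono mult_right_mono L2norm_divg_le pw_poly_F) auto
  also have "\<dots> = ?G b * (?G a + real CARD('d) * inverse \<epsilon> * ?D a)"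
    by (simp add: algebra_simps)
  also have "\<dots> \<le> (C1 * inverse h * (c2 * (vnorm N b / sqrt (real N)))) * (?G a + real CARD('d) * inverse \<epsilon> * ?D a)"
  proof (rule mult_right_mono)
    have "?G b \<le> C1 * inverse h * L2norm \<Omega> (F b)" by (rule inverse_estimate)
    also have "\<dots> \<le> C1 * inverse h * (c2 * (vnorm N b / sqrt (real N)))"
      using C1_nonneg h_pos by (intro mult_left_mono L2norm_le_vnorm) auto
    finally show "?G b \<le> C1 * inverse h * (c2 * (vnorm N b / sqrt (real N)))" .
  qed (use assms nn in auto)
  finally show ?thesis by (simp add: mult_ac)
qed

text \<open>The choice \<open>b = z\<close> turns an estimate of a functional into one of the vector
  that represents it.\<close>

lemma vnorm_le_of_dual:
  assumes "\<And>b. (\<Sum>i<N. b i * z i) \<le> vnorm N b * K" and "0 \<le> K"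
  shows "vnorm N z \<le> K"
proof (cases "vnorm N z = 0")
  case False
  then have "0 < vnorm N z" using vnorm_nonneg[of N z] by simp
  moreover have "vnorm N z * vnorm N z \<le> vnorm N z * K"
    using assms(1)[of z] vnorm_power2[of N z] by (simp add: power2_eq_square)
  ultimately show ?thesis by simp
qed (use assms in simp)

lemma vnorm_mvmult_A_le:
  assumes "0 < \<epsilon>"
  shows "vnorm N (mvmult N (A \<epsilon>) a) \<le> C1 * inverse h * c2 / sqrt (real N) *
    (L2norm \<Omega> (grad (F a)) + real CARD('d) * inverse \<epsilon> * L2norm \<Omega> (divg (F a)))"
  using energy_le[OF assms, of _ a] C1_nonneg c2_pos h_pos assms
  by (intro vnorm_le_of_dual) (auto simp: sum_mvmult_A mult_ac L2norm_nonneg)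

lemma matnorm_A_le:
  assumes "0 < \<epsilon>"
  shows "matnorm N (A \<epsilon>) \<le> C1\<^sup>2 * c2\<^sup>2 * (real CARD('d))\<^sup>2 * (1 + inverse \<epsilon>) / h\<^sup>2 / real N"
proof (rule matnorm_le[OF N_pos])
  fix a
  let ?G = "L2norm \<Omega> (grad (F a))" and ?d = "real CARD('d)"
  have d: "1 \<le> ?d" using zero_less_card_finite[where 'a='d] by linarith
  then have d2: "1 \<le> ?d\<^sup>2" by simp
  have "?G \<le> C1 * inverse h * L2norm \<Omega> (F a)" by (rule inverse_estimate)
  also have "\<dots> \<le> C1 * inverse h * (c2 * (vnorm N a / sqrt (real N)))"
    using C1_nonneg h_pos by (intro mult_left_mono L2norm_le_vnorm) auto
  finally have G: "?G \<le> C1 * inverse h * (c2 * (vnorm N a / sqrt (real N)))" .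
  have "?G + ?d * inverse \<epsilon> * L2norm \<Omega> (divg (F a)) \<le> ?G + ?d * inverse \<epsilon> * (?d * ?G)"
    using assms by (intro add_left_mono mult_left_mono L2norm_divg_le pw_poly_F) auto
  also have "\<dots> = 1 * ?G + ?d\<^sup>2 * inverse \<epsilon> * ?G" by (simp add: power2_eq_square)
  \<comment> \<open>Since 1 \<le> d^2, the gradient term can share the constant of the penalty
    term.\<close>
  also have "\<dots> \<le> ?d\<^sup>2 * ?G + ?d\<^sup>2 * inverse \<epsilon> * ?G"
    using d2 by (intro add_right_mono mult_right_mono L2norm_nonneg)
  also have "\<dots> = ?d\<^sup>2 * (1 + inverse \<epsilon>) * ?G" by (simp add: algebra_simps)
  also have "\<dots> \<le> ?d\<^sup>2 * (1 + inverse \<epsilon>) * (C1 * inverse h * (c2 * (vnorm N a / sqrt (real N))))"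
    using assms by (intro mult_left_mono G) auto
  finally have "C1 * inverse h * c2 / sqrt (real N) * (?G + ?d * inverse \<epsilon> * L2norm \<Omega> (divg (F a))) \<le>
      C1 * inverse h * c2 / sqrt (real N) * (?d\<^sup>2 * (1 + inverse \<epsilon>) * (C1 * inverse h * (c2 * (vnorm N a / sqrt (real N)))))"
    using C1_nonneg h_pos c2_pos by (intro mult_left_mono) auto
  also have "\<dots> = C1\<^sup>2 * c2\<^sup>2 * ?d\<^sup>2 * (1 + inverse \<epsilon>) * (inverse h * inverse h) * vnorm N a / (sqrt (real N) * sqrt (real N))"
    by (simp add: power2_eq_square mult_ac)
  also have "\<dots> = C1\<^sup>2 * c2\<^sup>2 * ?d\<^sup>2 * (1 + inverse \<epsilon>) / h\<^sup>2 / real N * vnorm N a"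
    by (simp add: power2_eq_square divide_inverse mult_ac)
  finally show "vnorm N (mvmult N (A \<epsilon>) a) \<le> C1\<^sup>2 * c2\<^sup>2 * ?d\<^sup>2 * (1 + inverse \<epsilon>) / h\<^sup>2 / real N * vnorm N a"
    using vnorm_mvmult_A_le[OF assms, of a] by linarith
qed

text \<open>The penalty part of the energy is nonnegative and is dropped; the gradient part is
  bounded below by the Poincare inequality and the lower norm equivalence. The factor N comes from
  the weight 1/N in that equivalence.\<close>

lemma coercive:
  assumes "0 < \<epsilon>"
  shows "(vnorm N a)\<^sup>2 \<le> (2 * r + 1)\<^sup>2 / c1\<^sup>2 * real N * energy \<epsilon> a a"
proof -
  have "c1 * (vnorm N a / sqrt (real N)) \<le> (2 * r + 1) * L2norm \<Omega> (grad (F a))"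
    using vnorm_le_L2norm[of a] poincare[OF pw_poly_F r_pos dom_le, of a] by linarith
  then have "(c1 * (vnorm N a / sqrt (real N)))\<^sup>2 \<le> ((2 * r + 1) * L2norm \<Omega> (grad (F a)))\<^sup>2"
    using c1_pos vnorm_nonneg[of N a] by (intro power_mono) auto
  then have "c1\<^sup>2 * (vnorm N a)\<^sup>2 / real N \<le> (2 * r + 1)\<^sup>2 * L2ip \<Omega> (grad (F a)) (grad (F a))"
    by (simp add: power_mult_distrib power_divide L2norm_power2)
  also have "\<dots> \<le> (2 * r + 1)\<^sup>2 * energy \<epsilon> a a"
    using assms L2ip_nonneg[of \<Omega> "divg (F a)"] by (intro mult_left_mono) (auto simp: energy_def)
  finally show ?thesis using c1_pos N_pos by (simp add: field_simps)
qed

lemma A_inj: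
  assumes "0 < \<epsilon>" "\<And>i. i < N \<Longrightarrow> mvmult N (A \<epsilon>) a i = 0" "i < N"
  shows "a i = 0"
proof -
  have "energy \<epsilon> a a = 0" using assms(2) by (simp flip: sum_mvmult_A)
  then have "vnorm N a = 0" using coercive[OF assms(1), of a] by simp
  then show ?thesis using \<open>i < N\<close> by (simp add: vnorm_eq_0_iff)
qed

text \<open>For \<open>y\<close> solving \<open>A y = b\<close>, coercivity gives |y|^2 \<le> K (y,
  b) \<le> K |y| |b|, and a factor |y| cancels.\<close>

lemma matnorm_matinv_le:
  assumes "0 < \<epsilon>"
  shows "matnorm N (matinv N (A \<epsilon>)) \<le> (2 * r + 1)\<^sup>2 / c1\<^sup>2 * real N"
proof (rule matnorm_le[OF N_pos])
  fix b
  define y where "y = mvmult N (matinv N (A \<epsilon>)) b"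
  define K where "K = (2 * r + 1)\<^sup>2 / c1\<^sup>2 * real N"
  have K: "0 \<le> K" by (simp add: K_def)
  have "mvmult N (A \<epsilon>) y i = b i" if "i < N" for i
    unfolding y_def using A_inj[OF assms] that by (rule matinv_mvmult(2))
  then have "energy \<epsilon> y y = (\<Sum>i<N. y i * b i)" by (simp flip: sum_mvmult_A)
  also have "\<dots> \<le> vnorm N y * vnorm N b" by (rule vnorm_Cauchy_Schwarz)
  finally have "K * energy \<epsilon> y y \<le> K * (vnorm N y * vnorm N b)" using K by (rule mult_left_mono)
  then have "vnorm N y * vnorm N y \<le> vnorm N y * (K * vnorm N b)"
    using coercive[OF assms, of y] by (simp add: K_def power2_eq_square mult_ac)
  then show "vnorm N y \<le> K * vnorm N b"
    using K vnorm_nonneg[of N y] vnorm_nonneg[of N b]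
    by (cases "vnorm N y = 0") auto
qed

text \<open>The factor 1/N of \<open>matnorm_A_le\<close> cancels the factor N of
  \<open>matnorm_matinv_le\<close>.\<close>

lemma cond_num_le:
  assumes "0 < \<epsilon>"
  shows "cond_num N (A \<epsilon>) \<le>
    (2 * r + 1)\<^sup>2 / c1\<^sup>2 * c2\<^sup>2 * (C1\<^sup>2 * (real CARD('d))\<^sup>2) * ((1 + inverse \<epsilon>) / h\<^sup>2)"
proof -
  have "cond_num N (A \<epsilon>) \<le>
      (C1\<^sup>2 * c2\<^sup>2 * (real CARD('d))\<^sup>2 * (1 + inverse \<epsilon>) / h\<^sup>2 / real N) * ((2 * r + 1)\<^sup>2 / c1\<^sup>2 * real N)"
    unfolding cond_num_def using assms
    by (intro mult_mono matnorm_A_le matnorm_matinv_le matnorm_nonneg N_pos) auto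
  also have "\<dots> = (2 * r + 1)\<^sup>2 / c1\<^sup>2 * c2\<^sup>2 * (C1\<^sup>2 * (real CARD('d))\<^sup>2) * ((1 + inverse \<epsilon>) / h\<^sup>2)"
    using N_pos by (simp add: mult_ac)
  finally show ?thesis .
qed

section \<open>Effective condition numbers and right-hand sides\<close>

lemma eff_cond_le_cond_num:
  assumes "vnorm N c \<noteq> 0"
  shows "eff_cond N (A \<epsilon>) c \<le> cond_num N (A \<epsilon>)"
proof -
  have "0 < vnorm N c" using assms vnorm_nonneg[of N c] by simp
  then have "vnorm N (mvmult N (A \<epsilon>) c) / vnorm N c \<le> matnorm N (A \<epsilon>)"
    using vnorm_mvmult_le[of N "A \<epsilon>" c] by (simp add: field_simps)
  then have "matnorm N (matinv N (A \<epsilon>)) * (vnorm N (mvmult N (A \<epsilon>) c) / vnorm N c) \<le>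
      matnorm N (matinv N (A \<epsilon>)) * matnorm N (A \<epsilon>)"
    by (intro mult_left_mono matnorm_nonneg N_pos)
  then show ?thesis by (simp add: eff_cond_def cond_num_def mult.commute)
qed

text \<open>The variational equation tests with every element of the space, the linear system only
  with the basis; the assumption that pairing with \<open>f\<close> is linear on basis expansions
  closes the gap. It is verified for data of the form \<open>F d\<close>.\<close>

lemma penalty_solution_iff:
  assumes f: "\<And>b. L2ip \<Omega> f (F b) = (\<Sum>i<N. b i * L2ip \<Omega> f (\<phi> i))"
  shows "penalty_solution \<Omega> N \<phi> \<epsilon> f c \<longleftrightarrow> (\<forall>i<N. mvmult N (A \<epsilon>) c i = L2ip \<Omega> f (\<phi> i))"
proof
  assume s: "penalty_solution \<Omega> N \<phi> \<epsilon> f c"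
  show "\<forall>i<N. mvmult N (A \<epsilon>) c i = L2ip \<Omega> f (\<phi> i)"
  proof (intro allI impI)
    fix j assume j: "j < N"
    then have "\<phi> j \<in> fe_space N \<phi>" using F_unit[OF j] unfolding fe_space_eq by (metis rangeI)
    then have "L2ip \<Omega> (grad (F c)) (grad (\<phi> j)) + inverse \<epsilon> * L2ip \<Omega> (divg (F c)) (divg (\<phi> j)) = L2ip \<Omega> f (\<phi> j)"
      using s by (simp add: penalty_solution_def)
    then show "mvmult N (A \<epsilon>) c j = L2ip \<Omega> f (\<phi> j)"
      using j by (simp add: mvmult_A L2ip_commute)
  qed
next
  assume eq: "\<forall>i<N. mvmult N (A \<epsilon>) c i = L2ip \<Omega> f (\<phi> i)"
  have "energy \<epsilon> c b = L2ip \<Omega> f (F b)" for b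
  proof -
    have "energy \<epsilon> c b = (\<Sum>i<N. b i * mvmult N (A \<epsilon>) c i)"
      unfolding sum_mvmult_A by (rule energy_commute)
    also have "\<dots> = L2ip \<Omega> f (F b)" using eq by (simp add: f)
    finally show ?thesis .
  qed
  then show "penalty_solution \<Omega> N \<phi> \<epsilon> f c"
    by (auto simp: penalty_solution_def fe_space_eq energy_def)
qed

text \<open>Every vector is the load vector of some finite element function. A kernel vector of the
  Gram matrix represents a function of L2 norm zero, and the lower norm equivalence makes its
  coefficients vanish.\<close>

lemma gram_solve:
  obtains d where "\<And>i. i < N \<Longrightarrow> L2ip \<Omega> (F d) (\<phi> i) = z i"
proof -
  define G where "G i j = L2ip \<Omega> (\<phi> i) (\<phi> j)" for i j
  have G: "mvmult N G a i = L2ip \<Omega> (F a) (\<phi> i)" if "i < N" for a i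
    using L2ip_F_left[OF ess_bounded_pw_poly[OF basis[OF that]]]
    by (simp add: mvmult_def G_def L2ip_commute[of \<Omega> "\<phi> i"] mult.commute)
  have inj: "a i = 0" if "\<And>i. i < N \<Longrightarrow> mvmult N G a i = 0" "i < N" for a i
  proof -
    have "L2ip \<Omega> (F a) (F a) = (\<Sum>i<N. a i * L2ip \<Omega> (\<phi> i) (F a))"
      by (intro L2ip_F_left ess_bounded_pw_poly pw_poly_F)
    also have "\<dots> = 0" using that(1) G by (simp add: L2ip_commute[of \<Omega> _ "F a"])
    finally have "c1 * (vnorm N a / sqrt (real N)) \<le> 0"
      using vnorm_le_L2norm[of a] by (simp add: L2norm_def)
    then have "vnorm N a \<le> 0" using c1_pos N_pos by (simp add: mult_le_0_iff divide_le_0_iff)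
    then have "vnorm N a = 0" using vnorm_nonneg[of N a] by simp
    then show ?thesis using \<open>i < N\<close> by (simp add: vnorm_eq_0_iff)
  qed
  have "mvmult N G (mvmult N (matinv N G) z) i = z i" if "i < N" for i
    using inj that by (rule matinv_mvmult(2))
  then show thesis
    using G that[of "mvmult N (matinv N G) z"] by simp
qed

lemma L2_F: "L2 \<Omega> (F d)"
proof -
  have "ess_bounded \<Omega> (F d)" by (intro ess_bounded_pw_poly pw_poly_F)
  then show ?thesis
    using ess_bounded_integrable_inner[OF lmeasurable_dom, of "F d" "F d"]
    by (simp add: L2_def ess_bounded_def power2_norm_eq_inner)
qed

text \<open>The witness \<open>F d\<close> already lies in the finite element space, so it is its
  own projection. As |c| = 1, the quotient is the product of |A| and the norm of the
  inverse.\<close>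

lemma eff_cond_attained:
  "\<exists>f fh c. L2 \<Omega> f \<and> L2_projection \<Omega> N \<phi> f fh \<and> penalty_solution \<Omega> N \<phi> \<epsilon> f c
     \<and> vnorm N c \<noteq> 0 \<and> eff_cond N (A \<epsilon>) c = cond_num N (A \<epsilon>)"
proof -
  obtain c where c: "vnorm N c = 1" "vnorm N (mvmult N (A \<epsilon>) c) = matnorm N (A \<epsilon>)"
    using matnorm_attained[OF N_pos] by blast
  obtain d where d: "\<And>i. i < N \<Longrightarrow> L2ip \<Omega> (F d) (\<phi> i) = mvmult N (A \<epsilon>) c i"
    using gram_solve by blast
  have "L2ip \<Omega> (F d) (F b) = (\<Sum>i<N. b i * L2ip \<Omega> (F d) (\<phi> i))" for b
    using L2ip_F_left[OF ess_bounded_pw_poly[OF pw_poly_F], of b d] by (simp add: L2ip_commute[of \<Omega> "F d"])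
  then have "penalty_solution \<Omega> N \<phi> \<epsilon> (F d) c" using d by (subst penalty_solution_iff) auto
  moreover have "L2_projection \<Omega> N \<phi> (F d) (F d)" by (simp add: L2_projection_def fe_space_eq)
  moreover have "eff_cond N (A \<epsilon>) c = cond_num N (A \<epsilon>)" using c by (simp add: eff_cond_def cond_num_def)
  ultimately show ?thesis using c(1) L2_F by (intro exI[of _ "F d"] exI[of _ c]) auto
qed

text \<open>The common end of both bounds on the effective condition number: the inverse contributes
  N, the residual 1/sqrt N, and the upper norm equivalence bounds 1/|c| by \<open>c2\<close> / (sqrt
  N ||u||). Positivity of ||u|| is recorded because later computations divide by it.\<close>

lemma eff_cond_le_of_residual:
  assumes "0 < \<epsilon>" "vnorm N c \<noteq> 0" and le: "vnorm N (mvmult N (A \<epsilon>) c) \<le> c2 / sqrt (real N) * K"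
  shows "eff_cond N (A \<epsilon>) c \<le> (2 * r + 1)\<^sup>2 / c1\<^sup>2 * c2\<^sup>2 * (K / L2norm \<Omega> (F c))"
    and "0 < L2norm \<Omega> (F c)"
proof -
  have c: "0 < vnorm N c" using assms(2) vnorm_nonneg[of N c] by simp
  then have "0 < c1 * (vnorm N c / sqrt (real N))" using c1_pos N_pos by simp
  then show u: "0 < L2norm \<Omega> (F c)" using vnorm_le_L2norm[of c] by linarith
  have K: "0 \<le> c2 / sqrt (real N) * K" using le vnorm_nonneg[of N "mvmult N (A \<epsilon>) c"] by linarith
  have "1 / vnorm N c \<le> c2 / sqrt (real N) / L2norm \<Omega> (F c)"
    using L2norm_le_vnorm[of c] c u N_pos by (simp add: field_simps)
  then have "matnorm N (matinv N (A \<epsilon>)) * vnorm N (mvmult N (A \<epsilon>) c) * (1 / vnorm N c) \<le>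
     ((2 * r + 1)\<^sup>2 / c1\<^sup>2 * real N) * (c2 / sqrt (real N) * K) * (c2 / sqrt (real N) / L2norm \<Omega> (F c))"
    using assms(1) c by (intro mult_mono matnorm_matinv_le mult_nonneg_nonneg[OF _ K] le) (auto simp: vnorm_nonneg)
  also have "K0 * n * (c2 / s * K) * (c2 / s / u) = K0 * c2\<^sup>2 * (K / u) * (n / (s * s))" for K0 n s u :: real
    by (simp add: power2_eq_square mult_ac)
  also have "real N / (sqrt (real N) * sqrt (real N)) = 1"
    using N_pos by simp
  finally show "eff_cond N (A \<epsilon>) c \<le> (2 * r + 1)\<^sup>2 / c1\<^sup>2 * c2\<^sup>2 * (K / L2norm \<Omega> (F c))"
    by (simp add: eff_cond_def)
qed

lemma eff_cond_le_projection:
  assumes "0 < \<epsilon>" "vnorm N c \<noteq> 0"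
    and proj: "L2_projection \<Omega> N \<phi> f fh" and sol: "penalty_solution \<Omega> N \<phi> \<epsilon> f c"
  shows "eff_cond N (A \<epsilon>) c \<le> (2 * r + 1)\<^sup>2 / c1\<^sup>2 * c2\<^sup>2 * (L2norm \<Omega> fh / L2norm \<Omega> (F c))"
proof (rule eff_cond_le_of_residual(1)[OF assms(1,2)])
  obtain d where d: "fh = F d" using proj by (auto simp: L2_projection_def fe_space_eq)
  \<comment> \<open>Replacing \<open>f\<close> by its projection leaves the pairing with test
    functions unchanged and puts a finite element function in both arguments, so Cauchy--Schwarz for
    essentially bounded functions applies.\<close>
  have "energy \<epsilon> b c = L2ip \<Omega> fh (F b)" for b
    using proj sol unfolding energy_commute[of \<epsilon> b]
    by (simp add: energy_def L2_projection_def penalty_solution_def fe_space_eq)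
  also have "L2ip \<Omega> fh (F b) \<le> vnorm N b * (c2 / sqrt (real N) * L2norm \<Omega> fh)" for b
  proof -
    have "L2ip \<Omega> fh (F b) \<le> L2norm \<Omega> fh * L2norm \<Omega> (F b)"
      unfolding d by (intro L2_Cauchy_Schwarz lmeasurable_dom ess_bounded_pw_poly pw_poly_F)
    also have "\<dots> \<le> L2norm \<Omega> fh * (c2 * (vnorm N b / sqrt (real N)))"
      by (intro mult_left_mono L2norm_le_vnorm L2norm_nonneg)
    finally show ?thesis by (simp add: mult_ac)
  qed
  finally show "vnorm N (mvmult N (A \<epsilon>) c) \<le> c2 / sqrt (real N) * L2norm \<Omega> fh"
    using c2_pos by (intro vnorm_le_of_dual) (auto simp: sum_mvmult_A L2norm_nonneg)
qed

lemma eff_cond_le_divergence: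
  assumes "0 < \<epsilon>" "vnorm N c \<noteq> 0"
  shows "eff_cond N (A \<epsilon>) c \<le> (2 * r + 1)\<^sup>2 / c1\<^sup>2 * c2\<^sup>2 * (C1 * (C1 + real CARD('d))) *
    (1 / h\<^sup>2 * (1 + h / \<epsilon> * (L2norm \<Omega> (divg (F c)) / L2norm \<Omega> (F c))))"
proof -
  let ?u = "L2norm \<Omega> (F c)" and ?D = "L2norm \<Omega> (divg (F c))" and ?d = "real CARD('d)"
  let ?K = "C1 * inverse h * (C1 * inverse h * ?u + ?d * inverse \<epsilon> * ?D)"
  have "vnorm N (mvmult N (A \<epsilon>) c) \<le> C1 * inverse h * c2 / sqrt (real N) *
      (L2norm \<Omega> (grad (F c)) + ?d * inverse \<epsilon> * ?D)"
    by (rule vnorm_mvmult_A_le[OF assms(1)])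
  also have "\<dots> \<le> C1 * inverse h * c2 / sqrt (real N) * (C1 * inverse h * ?u + ?d * inverse \<epsilon> * ?D)"
    using C1_nonneg h_pos c2_pos by (intro mult_left_mono add_right_mono inverse_estimate) auto
  finally have "vnorm N (mvmult N (A \<epsilon>) c) \<le> c2 / sqrt (real N) * ?K" by (simp add: mult_ac)
  note res = eff_cond_le_of_residual[OF assms this]
  have D: "0 \<le> ?D / ?u" by (simp add: L2norm_nonneg)
  \<comment> \<open>The divergence term carries one inverse power of h instead of two, so taking out
    1/h^2 leaves the factor h/\<epsilon> on it.\<close>
  have "?K / ?u = C1 / h\<^sup>2 * (C1 + ?d * (h / \<epsilon> * (?D / ?u)))"
    using res(2) h_pos assms(1) by (simp add: field_simps power2_eq_square)
  \<comment> \<open>\<open>C1\<close> and d are both enlarged to their sum, so that a single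
    constant factors out.\<close>
  also have "\<dots> \<le> C1 / h\<^sup>2 * ((C1 + ?d) * 1 + (C1 + ?d) * (h / \<epsilon> * (?D / ?u)))"
    using C1_nonneg h_pos assms(1) D
    by (intro mult_left_mono add_mono mult_right_mono) (auto simp: L2norm_nonneg)
  also have "C1 / h\<^sup>2 * ((C1 + ?d) * 1 + (C1 + ?d) * X) = (C1 * (C1 + ?d)) * (1 / h\<^sup>2 * (1 + X))" for X
    by (simp add: divide_inverse algebra_simps)
  finally have "?K / ?u \<le> (C1 * (C1 + ?d)) * (1 / h\<^sup>2 * (1 + h / \<epsilon> * (?D / ?u)))" .
  then have "(2 * r + 1)\<^sup>2 / c1\<^sup>2 * c2\<^sup>2 * (?K / ?u) \<le>
     (2 * r + 1)\<^sup>2 / c1\<^sup>2 * c2\<^sup>2 * ((C1 * (C1 + ?d)) * (1 / h\<^sup>2 * (1 + h / \<epsilon> * (?D / ?u))))"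
    by (rule mult_left_mono) simp
  then show ?thesis using res(1) by (simp only: mult.assoc)
qed

end

theorem theorem2p1:
  fixes \<Omega> :: "(real^'d) set"
    and H :: "real set"
    and \<T> :: "real \<Rightarrow> (real^'d) set set"
    and N :: "real \<Rightarrow> nat"
    and \<phi> :: "real \<Rightarrow> nat \<Rightarrow> real^'d \<Rightarrow> real^'d"
  assumes dim: "CARD('d) = 2 \<or> CARD('d) = 3"
    and domain: "polyhedral_domain \<Omega>"
    and fe: "\<forall>h\<in>H. 0 < h \<and> is_mesh \<Omega> h (\<T> h) \<and> fe_basis \<Omega> (\<T> h) (N h) (\<phi> h)"
    and A1: "\<exists>C. \<forall>h\<in>H. \<forall>v\<in>fe_space (N h) (\<phi> h). L2norm \<Omega> (grad v) \<le> C * inverse h * L2norm \<Omega> v"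
    and A2_dim: "\<exists>c1 c2. 0 < c1 \<and> 0 < c2 \<and>
       (\<forall>h\<in>H. c1 * h powr (- real CARD('d)) \<le> real (N h) \<and> real (N h) \<le> c2 * h powr (- real CARD('d)))"
    and A2: "\<exists>c1 c2. 0 < c1 \<and> 0 < c2 \<and> (\<forall>h\<in>H. \<forall>a.
       c1 * sqrt ((\<Sum>i<N h. (a i)\<^sup>2) / real (N h)) \<le> L2norm \<Omega> (fe_fun (N h) (\<phi> h) a) \<and>
       L2norm \<Omega> (fe_fun (N h) (\<phi> h) a) \<le> c2 * sqrt ((\<Sum>i<N h. (a i)\<^sup>2) / real (N h)))"
  shows "\<exists>C. \<forall>h\<in>H. \<forall>\<epsilon>>0.
     (\<forall>f fh c. L2 \<Omega> f \<and> L2_projection \<Omega> (N h) (\<phi> h) f fh \<and> penalty_solution \<Omega> (N h) (\<phi> h) \<epsilon> f c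
         \<and> vnorm (N h) c \<noteq> 0 \<longrightarrow>
         eff_cond (N h) (penalty_matrix \<Omega> (\<phi> h) \<epsilon>) c \<le> cond_num (N h) (penalty_matrix \<Omega> (\<phi> h) \<epsilon>)) \<and>
     (\<exists>f fh c. L2 \<Omega> f \<and> L2_projection \<Omega> (N h) (\<phi> h) f fh \<and> penalty_solution \<Omega> (N h) (\<phi> h) \<epsilon> f c
         \<and> vnorm (N h) c \<noteq> 0 \<and>
         eff_cond (N h) (penalty_matrix \<Omega> (\<phi> h) \<epsilon>) c = cond_num (N h) (penalty_matrix \<Omega> (\<phi> h) \<epsilon>)) \<and>
     cond_num (N h) (penalty_matrix \<Omega> (\<phi> h) \<epsilon>) \<le> C * (h powr (-2) + inverse \<epsilon> * h powr (-2)) \<and>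
     (\<forall>f fh c. L2 \<Omega> f \<and> L2_projection \<Omega> (N h) (\<phi> h) f fh \<and> penalty_solution \<Omega> (N h) (\<phi> h) \<epsilon> f c
         \<and> vnorm (N h) c \<noteq> 0 \<longrightarrow>
         eff_cond (N h) (penalty_matrix \<Omega> (\<phi> h) \<epsilon>) c
           \<le> C * L2norm \<Omega> fh / L2norm \<Omega> (fe_fun (N h) (\<phi> h) c) \<and>
         eff_cond (N h) (penalty_matrix \<Omega> (\<phi> h) \<epsilon>) c
           \<le> C * h powr (-2) * (1 + h / \<epsilon> * (L2norm \<Omega> (divg (fe_fun (N h) (\<phi> h) c))
                                             / L2norm \<Omega> (fe_fun (N h) (\<phi> h) c))))"
proof -
  from A1 obtain C1 where C1: "\<forall>h\<in>H. \<forall>v\<in>fe_space (N h) (\<phi> h). L2norm \<Omega> (grad v) \<le> C1 * inverse h * L2norm \<Omega> v"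
    by blast
  from A2_dim obtain k where k: "0 < k" "\<forall>h\<in>H. k * h powr (- real CARD('d)) \<le> real (N h)" by blast
  from A2 obtain c1 c2 where c: "0 < c1" "0 < c2" and A2': "\<forall>h\<in>H. \<forall>a.
       c1 * sqrt ((\<Sum>i<N h. (a i)\<^sup>2) / real (N h)) \<le> L2norm \<Omega> (fe_fun (N h) (\<phi> h) a) \<and>
       L2norm \<Omega> (fe_fun (N h) (\<phi> h) a) \<le> c2 * sqrt ((\<Sum>i<N h. (a i)\<^sup>2) / real (N h))" by blast
  have "bounded \<Omega>" using domain unfolding polyhedral_domain_def by (elim conjE)
  then obtain r where r: "0 < r" "\<forall>x\<in>\<Omega>. norm x \<le> r" by (auto simp: bounded_pos)
  define D where "D = real CARD('d)"
  define P where "P = (2 * r + 1)\<^sup>2 / c1\<^sup>2 * c2\<^sup>2"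
  \<comment> \<open>The three summands are the constants of the projection bound, of the condition
    number and of the divergence bound; all are nonnegative, so \<open>C\<close> dominates
    each.\<close>
  define C where "C = P * (1 + \<bar>C1\<bar>\<^sup>2 * D\<^sup>2 + \<bar>C1\<bar> * (\<bar>C1\<bar> + D))"
  have D: "0 \<le> D" and P: "0 \<le> P" by (simp_all add: D_def P_def)
  have C: "P \<le> C" "P * (\<bar>C1\<bar>\<^sup>2 * D\<^sup>2) \<le> C" "P * (\<bar>C1\<bar> * (\<bar>C1\<bar> + D)) \<le> C"
  proof -
    have "0 \<le> \<bar>C1\<bar>\<^sup>2 * D\<^sup>2" "0 \<le> \<bar>C1\<bar> * (\<bar>C1\<bar> + D)" using D by auto
    then show "P * (\<bar>C1\<bar>\<^sup>2 * D\<^sup>2) \<le> C" "P * (\<bar>C1\<bar> * (\<bar>C1\<bar> + D)) \<le> C"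
      unfolding C_def using P by (auto intro!: mult_left_mono)
    have "P * 1 \<le> C" unfolding C_def
      using P \<open>0 \<le> \<bar>C1\<bar>\<^sup>2 * D\<^sup>2\<close> \<open>0 \<le> \<bar>C1\<bar> * (\<bar>C1\<bar> + D)\<close> by (intro mult_left_mono) auto
    then show "P \<le> C" by simp
  qed
  have fem: "penalty_fem \<Omega> h (\<T> h) (N h) (\<phi> h) r \<bar>C1\<bar> c1 c2" if h: "h \<in> H" for h
  proof
    show "polyhedral_domain \<Omega>" "is_mesh \<Omega> h (\<T> h)" "0 < h" "0 < r" "0 \<le> \<bar>C1\<bar>" "0 < c1" "0 < c2"
      using domain fe h r c by auto
    \<comment> \<open>The lower dimension bound makes \<open>N h\<close> positive, so unit vectors
      exist and divisions by N are meaningful.\<close>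
    then have "0 < k * h powr (- real CARD('d))" using k(1) by simp
    moreover have "k * h powr (- real CARD('d)) \<le> real (N h)" using k(2) h by blast
    ultimately have "0 < real (N h)" by linarith
    then show "0 < N h" by simp
    show "pw_poly \<Omega> (\<T> h) (\<phi> h i)" if "i < N h" for i
      using fe h that by (simp add: fe_basis_def pw_poly_def)
    show "norm x \<le> r" if "x \<in> \<Omega>" for x using r that by blast
    fix a
    have "fe_fun (N h) (\<phi> h) a \<in> fe_space (N h) (\<phi> h)" by (auto simp: fe_space_def fe_fun_def)
    then have "L2norm \<Omega> (grad (fe_fun (N h) (\<phi> h) a)) \<le> C1 * inverse h * L2norm \<Omega> (fe_fun (N h) (\<phi> h) a)"
      using C1 h by blast
    \<comment> \<open>The inverse estimate comes with a constant of unspecified sign; its absolute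
      value is nonnegative as the locale asks.\<close>
    also have "\<dots> \<le> \<bar>C1\<bar> * inverse h * L2norm \<Omega> (fe_fun (N h) (\<phi> h) a)"
      using \<open>0 < h\<close> by (intro mult_right_mono L2norm_nonneg) auto
    finally show "L2norm \<Omega> (grad (fe_fun (N h) (\<phi> h) a)) \<le> \<bar>C1\<bar> * inverse h * L2norm \<Omega> (fe_fun (N h) (\<phi> h) a)" .
    show "c1 * (vnorm (N h) a / sqrt (real (N h))) \<le> L2norm \<Omega> (fe_fun (N h) (\<phi> h) a)"
      "L2norm \<Omega> (fe_fun (N h) (\<phi> h) a) \<le> c2 * (vnorm (N h) a / sqrt (real (N h)))"
      using A2' h by (simp_all add: vnorm_def real_sqrt_divide)
  qed
  show ?thesis
  proof (intro exI[of _ C] ballI allI impI)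
    fix h \<epsilon> :: real assume h: "h \<in> H" and e: "0 < \<epsilon>"
    interpret penalty_fem \<Omega> h "\<T> h" "N h" "\<phi> h" r "\<bar>C1\<bar>" c1 c2 using h by (rule fem)
    have hp: "h powr (-2) = 1 / h\<^sup>2"
      using h_pos by (simp add: powr_minus_divide)
    have 1: "cond_num (N h) (penalty_matrix \<Omega> (\<phi> h) \<epsilon>) \<le> C * (h powr (-2) + inverse \<epsilon> * h powr (-2))"
    proof -
      have "cond_num (N h) (penalty_matrix \<Omega> (\<phi> h) \<epsilon>) \<le> P * (\<bar>C1\<bar>\<^sup>2 * D\<^sup>2) * ((1 + inverse \<epsilon>) / h\<^sup>2)"
        using cond_num_le[OF e] by (simp only: P_def D_def)
      also have "\<dots> \<le> C * ((1 + inverse \<epsilon>) / h\<^sup>2)"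
        using e C by (intro mult_right_mono) auto
      finally show ?thesis by (simp add: hp divide_inverse distrib_right)
    qed
    have 2: "eff_cond (N h) (penalty_matrix \<Omega> (\<phi> h) \<epsilon>) c
           \<le> C * L2norm \<Omega> fh / L2norm \<Omega> (fe_fun (N h) (\<phi> h) c)"
      if "L2_projection \<Omega> (N h) (\<phi> h) f fh" "penalty_solution \<Omega> (N h) (\<phi> h) \<epsilon> f c" "vnorm (N h) c \<noteq> 0" for f fh c
    proof -
      have "eff_cond (N h) (penalty_matrix \<Omega> (\<phi> h) \<epsilon>) c
           \<le> P * (L2norm \<Omega> fh / L2norm \<Omega> (fe_fun (N h) (\<phi> h) c))"
        using eff_cond_le_projection[OF e that(3,1,2)] by (simp only: P_def)
      also have "\<dots> \<le> C * (L2norm \<Omega> fh / L2norm \<Omega> (fe_fun (N h) (\<phi> h) c))"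
        using C by (intro mult_right_mono) (auto simp: L2norm_nonneg)
      finally show ?thesis by simp
    qed
    have 3: "eff_cond (N h) (penalty_matrix \<Omega> (\<phi> h) \<epsilon>) c
           \<le> C * h powr (-2) * (1 + h / \<epsilon> * (L2norm \<Omega> (divg (fe_fun (N h) (\<phi> h) c))
                                             / L2norm \<Omega> (fe_fun (N h) (\<phi> h) c)))"
      if "vnorm (N h) c \<noteq> 0" for c
    proof -
      let ?X = "1 / h\<^sup>2 * (1 + h / \<epsilon> * (L2norm \<Omega> (divg (fe_fun (N h) (\<phi> h) c)) / L2norm \<Omega> (fe_fun (N h) (\<phi> h) c)))"
      have "eff_cond (N h) (penalty_matrix \<Omega> (\<phi> h) \<epsilon>) c \<le> P * (\<bar>C1\<bar> * (\<bar>C1\<bar> + D)) * ?X"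
        using eff_cond_le_divergence[OF e that] by (simp only: P_def D_def)
      also have "\<dots> \<le> C * ?X"
        using C e h_pos by (intro mult_right_mono) (auto simp: L2norm_nonneg)
      finally show ?thesis by (simp only: hp mult.assoc)
    qed
    show "(\<forall>f fh c. L2 \<Omega> f \<and> L2_projection \<Omega> (N h) (\<phi> h) f fh \<and> penalty_solution \<Omega> (N h) (\<phi> h) \<epsilon> f c
         \<and> vnorm (N h) c \<noteq> 0 \<longrightarrow>
         eff_cond (N h) (penalty_matrix \<Omega> (\<phi> h) \<epsilon>) c \<le> cond_num (N h) (penalty_matrix \<Omega> (\<phi> h) \<epsilon>)) \<and>
     (\<exists>f fh c. L2 \<Omega> f \<and> L2_projection \<Omega> (N h) (\<phi> h) f fh \<and> penalty_solution \<Omega> (N h) (\<phi> h) \<epsilon> f c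
         \<and> vnorm (N h) c \<noteq> 0 \<and>
         eff_cond (N h) (penalty_matrix \<Omega> (\<phi> h) \<epsilon>) c = cond_num (N h) (penalty_matrix \<Omega> (\<phi> h) \<epsilon>)) \<and>
     cond_num (N h) (penalty_matrix \<Omega> (\<phi> h) \<epsilon>) \<le> C * (h powr (-2) + inverse \<epsilon> * h powr (-2)) \<and>
     (\<forall>f fh c. L2 \<Omega> f \<and> L2_projection \<Omega> (N h) (\<phi> h) f fh \<and> penalty_solution \<Omega> (N h) (\<phi> h) \<epsilon> f c
         \<and> vnorm (N h) c \<noteq> 0 \<longrightarrow>
         eff_cond (N h) (penalty_matrix \<Omega> (\<phi> h) \<epsilon>) c
           \<le> C * L2norm \<Omega> fh / L2norm \<Omega> (fe_fun (N h) (\<phi> h) c) \<and>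
         eff_cond (N h) (penalty_matrix \<Omega> (\<phi> h) \<epsilon>) c
           \<le> C * h powr (-2) * (1 + h / \<epsilon> * (L2norm \<Omega> (divg (fe_fun (N h) (\<phi> h) c))
                                             / L2norm \<Omega> (fe_fun (N h) (\<phi> h) c))))"
      by (intro conjI allI impI eff_cond_attained 1; (elim conjE)?;
          (rule eff_cond_le_cond_num 2 3; assumption))
  qed
qed

end
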